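(* In the setting described in the context (with $\alpha\in(1,2)$ and $\beta>\frac12+\frac1{2\alpha}$), let $Z_t=\int_0^te^{-A(t-s)}\,dL_s$ be the stochastic $\alpha$-stable convolution. Let $T>0$ be arbitrary. For all $0\le\theta<\beta-\frac1{2\alpha}$ and all $0<p<\alpha$, $$\mathbb E\sup_{0\le t\le T}\|A^\theta Z_t\|_H^p\le C\,T^{p/\alpha},$$ where the constant $C$ depends on $\alpha,\theta,\beta,p$ (and not on $T$).
   Context: Let $\mathbb T=\mathbb R/\mathbb Z$ with Lebesgue measure $d\xi$, and let $H=\{x\in L^2(\mathbb T,\mathbb R):\int_{\mathbb T}x(\xi)\,d\xi=0\}$ with the $L^2$ inner product. $A$ is the closure in $H$ of $-\frac{d^2}{d\xi^2}$ on $C^2(\mathbb T)\cap H$. Let $\mathbb Z_*=\mathbb Z\setminus\{0\}$, $\gamma_k=4\pi^2|k|^2$, and let $\{e_k\}_{k\in\mathbb Z_*}$ be the orthonormal basis of $H$ given by $e_k(\xi)=\sqrt2\cos(2\pi k\xi)$ for $k\ge1$ and $e_k(\xi)=\sqrt2\sin(2\pi|k|\xi)$ for $k\le-1$, so $Ae_k=\gamma_ke_k$. For $\theta\ge0$ and $x=\sum_kx_ke_k$, $\|A^\theta x\|_H^2=\sum_k\gamma_k^{2\theta}|x_k|^2$. Noise: $\alpha\in(1,2)$; $(l_k(t))_{t\ge 0}$, $k\in\mathbb Z_*$, are i.i.d. one-dimensional symmetric $\alpha$-stable processes with càdlàg paths on a probability space $(\Omega,\mathcal F,\mathbb P)$,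 with $\mathbb E[e^{i\lambda l_k(t)}]=e^{-t|\lambda|^\alpha}$. The real sequence $(\beta_k)_{k\in\mathbb Z_*}$ is fixed once and for all and satisfies $C_1\gamma_k^{-\beta}\le|\beta_k|\le C_2\gamma_k^{-\beta}$ for some constants $C_1,C_2>0$ and some $\beta>\frac12+\frac1{2\alpha}$. $L_t=\sum_{k\in\mathbb Z_*}\beta_kl_k(t)e_k$, and $$Z_t=\int_0^te^{-A(t-s)}\,dL_s=\sum_{k\in\mathbb Z_*}z_k(t)e_k,\qquad z_k(t)=\int_0^te^{-\gamma_k(t-s)}\beta_k\,dl_k(s),$$ with càdlàg versions of the $z_k$. *)

theory Defs
  imports "HOL-Probability.Probability"
begin

section \<open>The space \<open>H\<close> and the powers of \<open>A\<close>\<close>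

text \<open>Functions on \<open>\<real>/\<int>\<close> are represented by their values on the fundamental domain \<open>{0..<1}\<close>;
  elements of \<open>H\<close> are represented by functions, not by their almost-everywhere classes.\<close>

definition torus :: "real measure" where
  "torus = restrict_space lborel {0..<1}"

definition H :: "(real \<Rightarrow> real) set" where
  "H = {x. x \<in> borel_measurable torus \<and> integrable torus (\<lambda>\<xi>. (x \<xi>)\<^sup>2) \<and> (LINT \<xi>|torus. x \<xi>) = 0}"

definition inner_H :: "(real \<Rightarrow> real) \<Rightarrow> (real \<Rightarrow> real) \<Rightarrow> real" where
  "inner_H x y = (LINT \<xi>|torus. x \<xi> * y \<xi>)"

definition norm_H :: "(real \<Rightarrow> real) \<Rightarrow> real" where
  "norm_H x = sqrt (inner_H x x)"

definition Zstar :: "int set" where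
  "Zstar = UNIV - {0}"

definition eigval :: "int \<Rightarrow> real" where
  "eigval k = 4 * pi\<^sup>2 * \<bar>of_int k\<bar>\<^sup>2"

definition eigfun :: "int \<Rightarrow> real \<Rightarrow> real" where
  "eigfun k \<xi> = (if k \<ge> 1 then sqrt 2 * cos (2 * pi * of_int k * \<xi>)
                 else sqrt 2 * sin (2 * pi * \<bar>of_int k\<bar> * \<xi>))"

text \<open>\<open>A\<close> is the closure of \<open>- d\<^sup>2/d\<xi>\<^sup>2\<close>; this is \<open>A e\<^sub>k = \<gamma>\<^sub>k e\<^sub>k\<close>.\<close>

lemma eigfun_eigval:
  obtains d where "\<And>\<xi>. (eigfun k has_real_derivative d \<xi>) (at \<xi>)"
    and "\<And>\<xi>. (d has_real_derivative - (eigval k * eigfun k \<xi>)) (at \<xi>)"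
proof (cases "k \<ge> 1")
  case True
  show thesis
  proof (rule that)
    show "(eigfun k has_real_derivative - (sqrt 2 * (2 * pi * of_int k) * sin (2 * pi * of_int k * \<xi>))) (at \<xi>)" for \<xi>
      unfolding eigfun_def using True by (auto intro!: derivative_eq_intros)
    show "((\<lambda>\<xi>. - (sqrt 2 * (2 * pi * of_int k) * sin (2 * pi * of_int k * \<xi>)))
        has_real_derivative - (eigval k * eigfun k \<xi>)) (at \<xi>)" for \<xi>
      unfolding eigfun_def eigval_def using True
      by (auto intro!: derivative_eq_intros simp: power2_eq_square algebra_simps)
  qed
next
  case False
  show thesis
  proof (rule that)
    show "(eigfun k has_real_derivative sqrt 2 * (2 * pi * \<bar>of_int k\<bar>) * cos (2 * pi * \<bar>of_int k\<bar> * \<xi>)) (at \<xi>)" for \<xi>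
      unfolding eigfun_def using False by (auto intro!: derivative_eq_intros)
    show "((\<lambda>\<xi>. sqrt 2 * (2 * pi * \<bar>of_int k\<bar>) * cos (2 * pi * \<bar>of_int k\<bar> * \<xi>))
        has_real_derivative - (eigval k * eigfun k \<xi>)) (at \<xi>)" for \<xi>
      unfolding eigfun_def eigval_def using False
      by (auto intro!: derivative_eq_intros simp: power2_eq_square algebra_simps)
  qed
qed

text \<open>Real powers on \<open>[0, \<infinity>]\<close>, intended for exponents \<open>a > 0\<close>.\<close>

definition epowr :: "ennreal \<Rightarrow> real \<Rightarrow> ennreal" where
  "epowr u a = (if u = \<infinity> then \<infinity> else ennreal (enn2real u powr a))"

text \<open>\<open>\<parallel>A\<^sup>\<theta> x\<parallel>\<close> for \<open>x \<in> H\<close>, through the expansion of \<open>x\<close> in the eigenbasis of \<open>A\<close>;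
  the value is \<open>\<infinity>\<close> when \<open>x\<close> is outside the domain of \<open>A\<^sup>\<theta>\<close>.\<close>

definition norm_A_pow :: "real \<Rightarrow> (real \<Rightarrow> real) \<Rightarrow> ennreal" where
  "norm_A_pow \<theta> x =
     epowr (\<Sum>\<^sub>\<infinity>k\<in>Zstar. ennreal (eigval k powr (2 * \<theta>) * \<bar>inner_H x (eigfun k)\<bar>\<^sup>2)) (1 / 2)"

definition series_conv_H :: "(int \<Rightarrow> real) \<Rightarrow> (real \<Rightarrow> real) \<Rightarrow> bool" where
  "series_conv_H c x \<longleftrightarrow> x \<in> H \<and>
     ((\<lambda>F. norm_H (\<lambda>\<xi>. x \<xi> - (\<Sum>k\<in>F. c k * eigfun k \<xi>))) \<longlongrightarrow> 0) (finite_subsets_at_top Zstar)"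

text \<open>The series \<open>\<Sum>\<^sub>k c\<^sub>k e\<^sub>k\<close> in \<open>H\<close>: a representative of its sum, and \<open>None\<close> if it diverges.
  A divergent series gets norm \<open>\<infinity>\<close> below, so that a finite bound includes
  convergence in \<open>H\<close>.\<close>

definition series_H :: "(int \<Rightarrow> real) \<Rightarrow> (real \<Rightarrow> real) option" where
  "series_H c = (if \<exists>x. series_conv_H c x then Some (SOME x. series_conv_H c x) else None)"

definition norm_A_pow_ext :: "real \<Rightarrow> (real \<Rightarrow> real) option \<Rightarrow> ennreal" where
  "norm_A_pow_ext \<theta> X = (case X of None \<Rightarrow> \<infinity> | Some x \<Rightarrow> norm_A_pow \<theta> x)"

section \<open>Stable processes and the stochastic convolution\<close>

definition cadlag :: "(real \<Rightarrow> real) \<Rightarrow> bool" where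
  "cadlag f \<longleftrightarrow> (\<forall>t\<ge>0. (f \<longlongrightarrow> f t) (at_right t)) \<and> (\<forall>t>0. \<exists>L. (f \<longlongrightarrow> L) (at_left t))"

context prob_space
begin

definition sym_stable_process :: "real \<Rightarrow> (real \<Rightarrow> 'a \<Rightarrow> real) \<Rightarrow> bool" where
  "sym_stable_process \<alpha> X \<longleftrightarrow>
     (\<forall>t\<ge>0. random_variable borel (X t)) \<and>
     (AE \<omega> in M. X 0 \<omega> = 0) \<and>
     (\<forall>(n::nat) (s::nat \<Rightarrow> real). 0 \<le> s 0 \<and> (\<forall>i<n. s i \<le> s (Suc i)) \<longrightarrow>
        indep_vars (\<lambda>_. borel) (\<lambda>i \<omega>. X (s (Suc i)) \<omega> - X (s i) \<omega>) {..<n}) \<and>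
     (\<forall>s\<ge>0. \<forall>h\<ge>0. distr M borel (\<lambda>\<omega>. X (s + h) \<omega> - X s \<omega>) = distr M borel (X h)) \<and>
     (\<forall>t\<ge>0. \<forall>u. char (distr M borel (X t)) u = complex_of_real (exp (- t * \<bar>u\<bar> powr \<alpha>))) \<and>
     (\<forall>\<omega>\<in>space M. cadlag (\<lambda>t. X t \<omega>))"

text \<open>\<open>I = \<integral>\<^sub>0\<^sup>t f(s) dX(s)\<close> for a continuous deterministic \<open>f\<close>: the limit in probability of the
  left-endpoint sums over partitions of \<open>[0, t]\<close> as the mesh tends to \<open>0\<close>.\<close>

definition has_stoch_integral ::
  "(real \<Rightarrow> 'a \<Rightarrow> real) \<Rightarrow> (real \<Rightarrow> real) \<Rightarrow> real \<Rightarrow> ('a \<Rightarrow> real) \<Rightarrow> bool" where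
  "has_stoch_integral X f t I \<longleftrightarrow>
     random_variable borel I \<and>
     (\<forall>\<epsilon>>0. \<exists>\<delta>>0. \<forall>(n::nat) (s::nat \<Rightarrow> real).
        s 0 = 0 \<and> s n = t \<and> (\<forall>i<n. s i \<le> s (Suc i) \<and> s (Suc i) - s i < \<delta>) \<longrightarrow>
        prob {\<omega> \<in> space M. \<bar>(\<Sum>i<n. f (s i) * (X (s (Suc i)) \<omega> - X (s i) \<omega>)) - I \<omega>\<bar> > \<epsilon>} < \<epsilon>)"

end

locale stable_convolution = prob_space M for M :: "'a measure" +
  fixes \<alpha> :: real and b :: "int \<Rightarrow> real" and l z :: "int \<Rightarrow> real \<Rightarrow> 'a \<Rightarrow> real"
  assumes stable: "\<And>k. k \<in> Zstar \<Longrightarrow> sym_stable_process \<alpha> (l k)"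
    and indep: "indep_vars (\<lambda>_. Pi\<^sub>M {0..} (\<lambda>_. borel)) (\<lambda>k \<omega>. \<lambda>t\<in>{0..}. l k t \<omega>) Zstar"
    and convolution: "\<And>k t. k \<in> Zstar \<Longrightarrow> 0 \<le> t \<Longrightarrow>
          has_stoch_integral (l k) (\<lambda>s. exp (- eigval k * (t - s)) * b k) t (z k t)"
    and cadlag_z: "\<And>k \<omega>. k \<in> Zstar \<Longrightarrow> \<omega> \<in> space M \<Longrightarrow> cadlag (\<lambda>t. z k t \<omega>)"

definition Z_conv :: "(int \<Rightarrow> real \<Rightarrow> 'a \<Rightarrow> real) \<Rightarrow> real \<Rightarrow> 'a \<Rightarrow> (real \<Rightarrow> real) option" where
  "Z_conv z t \<omega> = series_H (\<lambda>k. z k t \<omega>)"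

end

theory Submission
  imports Defs
begin

text \<open>By Riesz--Fischer, \<open>\<parallel>A\<^sup>\<theta> Z\<^sub>t\<parallel>\<^sup>2 = \<Sum>\<^sub>k \<gamma>\<^sub>k\<^bsup>2\<theta>\<^esup> z\<^sub>k(t)\<^sup>2\<close>, also when the series diverges. Summation by parts in the
  Riemann sums gives \<open>\<bar>z\<^sub>k(t)\<bar> \<le> 2 \<bar>\<beta>\<^sub>k\<bar> sup\<^sub>s\<^sub>\<le>\<^sub>t \<bar>l\<^sub>k(s)\<bar>\<close> almost surely, and a maximal inequality for independent
  increments gives \<open>P(sup\<^sub>s\<^sub>\<le>\<^sub>T \<bar>l\<^sub>k(s)\<bar> > x) \<le> K T x\<^bsup>-\<alpha>\<^esup>\<close>. Hence \<open>Y\<^sub>k = sup\<^sub>t \<gamma>\<^sub>k\<^bsup>2\<theta>\<^esup> z\<^sub>k(t)\<^sup>2\<close> has tail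
  \<open>A\<^sub>k y\<^bsup>-\<alpha>/2\<^esup>\<close> with \<open>\<Sum>\<^sub>k A\<^sub>k \<le> K' T\<close>, precisely because \<open>\<theta> < \<beta> - 1/(2\<alpha>)\<close>. As \<open>\<alpha>/2 < 1\<close>, truncation shows that
  \<open>\<Sum>\<^sub>k Y\<^sub>k\<close> has a tail of the same form, which bounds its moments of order \<open>p/2 < \<alpha>/2\<close>
  by a multiple of \<open>T\<^bsup>p/\<alpha>\<^esup>\<close>.\<close>

section \<open>Expansions in the eigenbasis\<close>

text \<open>Since \<alpha>/2 < 1, the tail bound gives no finite mean for \<open>Y k\<close>, so
  expectations cannot be summed. Subadditivity of u^(p/2) is no substitute: it would require the sum
  of the A_k^(p/\<alpha>) to be finite, a stronger condition because p < \<alpha>, and would shrink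
  the range of \<theta>. The summation is therefore carried out on tails, where the weights A_k
  enter linearly, and moments are taken last.

  The weight A_k is of order T \<gamma>_k^(-s) with s = (\<beta> - \<theta>) \<alpha>, and
  \<gamma>_k is of order k^2, so summability means 2 s > 1, that is \<theta> < \<beta> -
  1/(2\<alpha>). The tail of the sum is linear in T, and a moment of order p/2 of a variable with
  tail K T y^(-\<alpha>/2) scales like (K T)^(p/\<alpha>).

  A second obstacle is the supremum over uncountably many t, while the stochastic integral
  determines \<open>z k t\<close> only up to a null set for each t. Both are met by a countable grid
  in [0, T] and right-continuity, used mode by mode.\<close>

lemma (in prob_space) expectation_abs_le:
  fixes f :: "'a \<Rightarrow> real"
  assumes [measurable]: "f \<in> borel_measurable M" and "integrable M (\<lambda>x. (f x)\<^sup>2)" and "a > 0"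
  shows "2 * expectation (\<lambda>x. \<bar>f x\<bar>) \<le> expectation (\<lambda>x. (f x)\<^sup>2) / a + a"
proof -
  have "2 * \<bar>f x\<bar> \<le> (f x)\<^sup>2 / a + a" for x
  proof -
    have "0 \<le> (\<bar>f x\<bar> - a)\<^sup>2 / a" using \<open>a > 0\<close> by simp
    also have "\<dots> = (f x)\<^sup>2 / a + a - 2 * \<bar>f x\<bar>"
      using \<open>a > 0\<close> by (simp add: power2_diff field_simps power2_eq_square[of a])
    finally show ?thesis by simp
  qed
  moreover have "integrable M f"
    using assms(1,2) by (rule square_integrable_imp_integrable)
  ultimately have "expectation (\<lambda>x. 2 * \<bar>f x\<bar>) \<le> expectation (\<lambda>x. (f x)\<^sup>2 / a + a)"
    using assms(2) by (intro integral_mono) simp_all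
  then show ?thesis using assms by (simp add: prob_space)
qed

lemma integral_square_sum_orthonormal:
  fixes e :: "'i \<Rightarrow> 'a \<Rightarrow> real"
  assumes int: "\<And>i j. i \<in> F \<Longrightarrow> j \<in> F \<Longrightarrow> integrable M (\<lambda>x. e i x * e j x)"
    and orth: "\<And>i j. i \<in> F \<Longrightarrow> j \<in> F \<Longrightarrow> (LINT x|M. e i x * e j x) = (if i = j then 1 else 0)"
    and "finite F"
  shows "integrable M (\<lambda>x. (\<Sum>i\<in>F. c i * e i x)\<^sup>2)"
    and "(LINT x|M. (\<Sum>i\<in>F. c i * e i x)\<^sup>2) = (\<Sum>i\<in>F. (c i)\<^sup>2)"
proof -
  have eq: "(\<Sum>i\<in>F. c i * e i x)\<^sup>2 = (\<Sum>i\<in>F. \<Sum>j\<in>F. (c i * c j) * (e i x * e j x))" for x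
    unfolding power2_eq_square sum_product by (intro sum.cong refl) (simp add: mult_ac)
  show "integrable M (\<lambda>x. (\<Sum>i\<in>F. c i * e i x)\<^sup>2)"
    unfolding eq by (intro Bochner_Integration.integrable_sum integrable_mult_right int)
  have "(LINT x|M. (\<Sum>i\<in>F. c i * e i x)\<^sup>2)
    = (\<Sum>i\<in>F. \<Sum>j\<in>F. (c i * c j) * (LINT x|M. e i x * e j x))"
    unfolding eq by (simp add: Bochner_Integration.integral_sum int cong: sum.cong)
  also have "\<dots> = (\<Sum>i\<in>F. \<Sum>j\<in>F. if i = j then (c i)\<^sup>2 else 0)"
    by (intro sum.cong) (auto simp: orth power2_eq_square)
  also have "\<dots> = (\<Sum>i\<in>F. (c i)\<^sup>2)"
    using \<open>finite F\<close> by simp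
  finally show "(LINT x|M. (\<Sum>i\<in>F. c i * e i x)\<^sup>2) = (\<Sum>i\<in>F. (c i)\<^sup>2)" .
qed

text \<open>The partial sums are Cauchy in L^2, a sparse subsequence converges almost everywhere,
  and Fatou transfers the error bound to its limit. The error is bounded for every finite index set,
  not only for initial segments, because convergence in \<open>H\<close> is meant along the net of
  finite subsets.\<close>

lemma (in prob_space) riesz_fischer:
  fixes e :: "nat \<Rightarrow> 'a \<Rightarrow> real" and c :: "nat \<Rightarrow> real"
  assumes [measurable]: "\<And>i. e i \<in> borel_measurable M"
    and int: "\<And>i j. integrable M (\<lambda>x. e i x * e j x)"
    and orth: "\<And>i j. (LINT x|M. e i x * e j x) = (if i = j then 1 else 0)"
    and c: "summable (\<lambda>i. (c i)\<^sup>2)"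
  obtains g where "g \<in> borel_measurable M"
    "\<And>F. finite F \<Longrightarrow> (\<integral>\<^sup>+x. ennreal ((g x - (\<Sum>i\<in>F. c i * e i x))\<^sup>2) \<partial>M)
      \<le> ennreal ((\<Sum>i. (c i)\<^sup>2) - (\<Sum>i\<in>F. (c i)\<^sup>2))"
proof -
  define S where "S = (\<lambda>F x. \<Sum>i\<in>F. c i * e i x)"
  have S_meas [measurable]: "S F \<in> borel_measurable M" for F
    unfolding S_def by measurable
  have S_int: "integrable M (\<lambda>x. (S F x)\<^sup>2)" "expectation (\<lambda>x. (S F x)\<^sup>2) = (\<Sum>i\<in>F. (c i)\<^sup>2)"
    if "finite F" for F
    unfolding S_def using integral_square_sum_orthonormal[OF int orth that] by auto
  \<comment> \<open>These are squared norms: blocks with square norm below (1/4)^j have norm below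
    (1/2)^j, which is summable.\<close>
  have "\<exists>n. \<forall>m\<ge>n. \<forall>k. norm (\<Sum>i\<in>{m..<k}. (c i)\<^sup>2) < (1/4)^j" for j
    using c[unfolded summable_Cauchy] by (simp add: norm_power)
  then obtain n where n: "\<And>j m k. m \<ge> n j \<Longrightarrow> norm (\<Sum>i\<in>{m..<k}. (c i)\<^sup>2) < (1/4)^j"
    by metis
  \<comment> \<open>Cumulating makes \<open>N\<close> monotone and at least \<open>n j\<close>; the
    \<open>Suc\<close> also gives \<open>j \<le> N j\<close>, so the segments
    \<open>{..<N j}\<close> exhaust every finite set.\<close>
  define N where "N = (\<lambda>j. \<Sum>i\<le>j. Suc (n i))"
  have N_mono: "N j \<le> N (Suc j)" and N_n: "n j \<le> N j" and N_id: "j \<le> N j" for j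
  proof -
    show "N j \<le> N (Suc j)" by (simp add: N_def)
    show "n j \<le> N j" unfolding N_def by (cases j) auto
    show "j \<le> N j" unfolding N_def by (induction j) auto
  qed
  define D where "D = (\<lambda>j. S {N j..<N (Suc j)})"
  have D_meas [measurable]: "D j \<in> borel_measurable M" for j
    unfolding D_def by measurable
  have D_int: "integrable M (D j)" for j
    unfolding D_def by (rule square_integrable_imp_integrable[OF S_meas S_int(1)]) simp
  have D_le: "expectation (\<lambda>x. \<bar>D j x\<bar>) \<le> (1/2)^j" for j
  proof -
    \<comment> \<open>The free parameter of \<open>expectation_abs_le\<close> is taken as (1/2)^j,
      which balances its two terms.\<close>
    have "2 * expectation (\<lambda>x. \<bar>D j x\<bar>) \<le> expectation (\<lambda>x. (D j x)\<^sup>2) / (1/2)^j + (1/2)^j"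
      unfolding D_def by (intro expectation_abs_le S_meas S_int(1)) simp_all
    also have "expectation (\<lambda>x. (D j x)\<^sup>2) \<le> (1/4)^j"
      unfolding D_def S_int(2)[OF finite_atLeastLessThan]
      using n[OF N_n, of j "N (Suc j)"] by (simp add: sum_nonneg)
    also have "(1/4::real)^j / (1/2)^j = (1/2)^j"
      by (simp flip: power_divide)
    finally show ?thesis by (simp add: divide_right_mono)
  qed
  have "(\<integral>\<^sup>+x. (\<Sum>j. ennreal \<bar>D j x\<bar>) \<partial>M) = (\<Sum>j. \<integral>\<^sup>+x. ennreal \<bar>D j x\<bar> \<partial>M)"
    by (intro nn_integral_suminf) auto
  also have "\<dots> \<le> (\<Sum>j. ennreal ((1/2)^j))"
    using D_le D_int by (intro suminf_le) (auto simp: nn_integral_eq_integral intro!: ennreal_leI)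
  also have "\<dots> = ennreal (\<Sum>j. (1/2)^j)"
    by (intro suminf_ennreal2) (auto intro!: summable_geometric)
  also have "\<dots> < \<infinity>" by simp
  finally have "AE x in M. (\<Sum>j. ennreal \<bar>D j x\<bar>) \<noteq> \<infinity>"
    by (intro nn_integral_PInf_AE) auto
  then have AE_conv: "AE x in M. convergent (\<lambda>j. S {..<N j} x)"
  proof eventually_elim
    case (elim x)
    then have "summable (\<lambda>j. \<bar>D j x\<bar>)"
      by (intro summable_suminf_not_top) auto
    then have "summable (\<lambda>j. D j x)" by (rule summable_rabs_cancel)
    then have "convergent (\<lambda>k. (\<Sum>j<k. D j x) + S {..<N 0} x)"
      by (intro convergent_add convergent_const) (simp add: summable_iff_convergent)
    also have "(\<lambda>k. (\<Sum>j<k. D j x) + S {..<N 0} x) = (\<lambda>k. S {..<N k} x)"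
    proof
      show "(\<Sum>j<k. D j x) + S {..<N 0} x = S {..<N k} x" for k
      proof (induction k)
        case (Suc k)
        have "{..<N (Suc k)} = {..<N k} \<union> {N k..<N (Suc k)}" using N_mono[of k] by auto
        then have "S {..<N (Suc k)} x = S {..<N k} x + D k x"
          unfolding D_def S_def by (simp add: sum.union_disjoint ivl_disj_int)
        then show ?case using Suc by simp
      qed simp
    qed
    finally show ?case .
  qed
  define g where "g = (\<lambda>x. lim (\<lambda>j. S {..<N j} x))"
  show thesis
  proof (rule that)
    show [measurable]: "g \<in> borel_measurable M" unfolding g_def by measurable
    fix F :: "nat set" assume F: "finite F"
    have "(\<integral>\<^sup>+x. ennreal ((g x - S F x)\<^sup>2) \<partial>M)
      = (\<integral>\<^sup>+x. liminf (\<lambda>j. ennreal ((S {..<N j} x - S F x)\<^sup>2)) \<partial>M)"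
    proof (intro nn_integral_cong_AE, use AE_conv in eventually_elim)
      case (elim x)
      then have "(\<lambda>j. S {..<N j} x) \<longlonglongrightarrow> g x"
        unfolding g_def by (simp add: convergent_LIMSEQ_iff)
      then have "(\<lambda>j. ennreal ((S {..<N j} x - S F x)\<^sup>2)) \<longlonglongrightarrow> ennreal ((g x - S F x)\<^sup>2)"
        by (intro tendsto_intros)
      from lim_imp_Liminf[OF _ this] show ?case by simp
    qed
    \<comment> \<open>Fatou's lemma. The errors of the partial sums are exact by orthonormality as
      soon as \<open>{..<N j}\<close> contains \<open>F\<close>.\<close>
    also have "\<dots> \<le> liminf (\<lambda>j. \<integral>\<^sup>+x. ennreal ((S {..<N j} x - S F x)\<^sup>2) \<partial>M)"
      by (intro nn_integral_liminf) auto
    also have "\<dots> \<le> limsup (\<lambda>j. \<integral>\<^sup>+x. ennreal ((S {..<N j} x - S F x)\<^sup>2) \<partial>M)"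
      by (intro Liminf_le_Limsup) auto
    also have "\<dots> \<le> ennreal ((\<Sum>i. (c i)\<^sup>2) - (\<Sum>i\<in>F. (c i)\<^sup>2))"
    proof (rule Limsup_bounded)
      obtain m where m: "F \<subseteq> {..<m}" using F finite_nat_iff_bounded by blast
      have "(\<integral>\<^sup>+x. ennreal ((S {..<N j} x - S F x)\<^sup>2) \<partial>M)
          \<le> ennreal ((\<Sum>i. (c i)\<^sup>2) - (\<Sum>i\<in>F. (c i)\<^sup>2))" if "j \<ge> m" for j
      proof -
        have sub: "F \<subseteq> {..<N j}" using m that N_id[of j] by (meson lessThan_subset_iff order_trans)
        then have "S {..<N j} x - S F x = S ({..<N j} - F) x" for x
          unfolding S_def by (simp add: sum_diff)
        then have "(\<integral>\<^sup>+x. ennreal ((S {..<N j} x - S F x)\<^sup>2) \<partial>M) = ennreal (\<Sum>i\<in>{..<N j} - F. (c i)\<^sup>2)"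
          using S_int[of "{..<N j} - F"] by (simp add: nn_integral_eq_integral)
        also have "(\<Sum>i\<in>{..<N j} - F. (c i)\<^sup>2) = (\<Sum>i<N j. (c i)\<^sup>2) - (\<Sum>i\<in>F. (c i)\<^sup>2)"
          using sub by (simp add: sum_diff)
        also have "\<dots> \<le> (\<Sum>i. (c i)\<^sup>2) - (\<Sum>i\<in>F. (c i)\<^sup>2)"
          using c by (intro diff_right_mono sum_le_suminf) auto
        finally show ?thesis by (simp add: ennreal_leI)
      qed
      then show "\<forall>\<^sub>F j in sequentially. (\<integral>\<^sup>+x. ennreal ((S {..<N j} x - S F x)\<^sup>2) \<partial>M)
          \<le> ennreal ((\<Sum>i. (c i)\<^sup>2) - (\<Sum>i\<in>F. (c i)\<^sup>2))"
        by (auto simp: eventually_sequentially)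
    qed
    finally show "(\<integral>\<^sup>+x. ennreal ((g x - (\<Sum>i\<in>F. c i * e i x))\<^sup>2) \<partial>M)
      \<le> ennreal ((\<Sum>i. (c i)\<^sup>2) - (\<Sum>i\<in>F. (c i)\<^sup>2))" unfolding S_def .
  qed
qed

section \<open>The trigonometric system on the torus\<close>

lemma prob_space_torus: "prob_space torus"
  by (intro prob_spaceI) (simp add: torus_def emeasure_restrict_space space_restrict_space)

lemma borel_measurable_torus: "f \<in> borel_measurable borel \<Longrightarrow> f \<in> borel_measurable torus"
  unfolding torus_def by (intro measurable_restrict_space1) simp

lemma integrable_torus:
  fixes f :: "real \<Rightarrow> real"
  assumes "f \<in> borel_measurable borel" and "\<And>x. \<bar>f x\<bar> \<le> B"
  shows "integrable torus f"
proof -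
  interpret prob_space torus by (rule prob_space_torus)
  show ?thesis
    using assms by (intro integrable_const_bound[of _ B]) (auto intro: borel_measurable_torus)
qed

lemma integral_torus_FTC:
  fixes f F :: "real \<Rightarrow> real"
  assumes F: "\<And>x. (F has_real_derivative f x) (at x)" and f: "continuous_on UNIV f"
  shows "(LINT x|torus. f x) = F 1 - F 0"
proof -
  have [measurable]: "f \<in> borel_measurable borel"
    using f by (rule borel_measurable_continuous_onI)
  have "(LINT x|torus. f x) = (LINT x|lborel. indicator {0..<1} x *\<^sub>R f x)"
    unfolding torus_def by (subst integral_restrict_space) auto
  also have "\<dots> = (LINT x|lborel. f x * indicator {0..1} x)"
  proof (rule integral_cong_AE)
    show "AE x in lborel. indicator {0..<1} x *\<^sub>R f x = f x * indicator {0..1} x"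
      using AE_lborel_singleton[of 1] by eventually_elim (auto simp: indicator_def)
  qed auto
  also have "\<dots> = F 1 - F 0"
    using F f by (intro integral_FTC_Icc_real) (auto simp: continuous_on_eq_continuous_at)
  finally show ?thesis .
qed

lemma integral_torus_cos: "(LINT x|torus. cos (2 * pi * of_int m * x)) = (if m = 0 then 1 else 0)"
proof (cases "m = 0")
  case True
  interpret prob_space torus by (rule prob_space_torus)
  show ?thesis using True by (simp add: prob_space)
next
  case False
  have "(LINT x|torus. cos (2 * pi * of_int m * x))
      = sin (2 * pi * of_int m * 1) / (2 * pi * of_int m) - sin (2 * pi * of_int m * 0) / (2 * pi * of_int m)"
    using False by (intro integral_torus_FTC) (auto intro!: derivative_eq_intros continuous_intros)
  also have "\<dots> = 0" using sin_int_2pin[of m] by (simp add: mult_ac)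
  finally show ?thesis using False by simp
qed

lemma integral_torus_sin: "(LINT x|torus. sin (2 * pi * of_int m * x)) = 0"
proof (cases "m = 0")
  case False
  have "(LINT x|torus. sin (2 * pi * of_int m * x))
      = - cos (2 * pi * of_int m * 1) / (2 * pi * of_int m) - - cos (2 * pi * of_int m * 0) / (2 * pi * of_int m)"
    using False by (intro integral_torus_FTC) (auto intro!: derivative_eq_intros continuous_intros)
  also have "\<dots> = 0" using cos_int_2pin[of m] by (simp add: mult_ac)
  finally show ?thesis by simp
qed simp

lemma borel_measurable_eigfun [measurable]: "eigfun k \<in> borel_measurable borel"
  unfolding eigfun_def[abs_def] by measurable

lemma abs_eigfun_le: "\<bar>eigfun k x\<bar> \<le> sqrt 2"
  unfolding eigfun_def by (simp add: abs_mult)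

lemma integrable_eigfun: "integrable torus (eigfun k)"
  by (rule integrable_torus) (auto intro: abs_eigfun_le)

lemma integrable_eigfun_mult: "integrable torus (\<lambda>x. eigfun j x * eigfun k x)"
proof (rule integrable_torus)
  show "\<bar>eigfun j x * eigfun k x\<bar> \<le> sqrt 2 * sqrt 2" for x
    unfolding abs_mult by (intro mult_mono abs_eigfun_le) auto
qed simp

lemma integral_eigfun: "k \<in> Zstar \<Longrightarrow> (LINT x|torus. eigfun k x) = 0"
  using integral_torus_cos[of k] integral_torus_sin[of "\<bar>k\<bar>"]
  by (cases "k \<ge> 1") (auto simp: eigfun_def Zstar_def)

text \<open>Product-to-sum formulas leave the frequencies m - n and m + n. The sine modes are
  rewritten with the frequency \<open>- i\<close>, so that all frequencies are positive; then m + n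
  never vanishes and the diagonal comes from m - n alone.\<close>

lemma orthonormal_eigfun:
  assumes "j \<in> Zstar" "k \<in> Zstar"
  shows "(LINT x|torus. eigfun j x * eigfun k x) = (if j = k then 1 else 0)"
proof -
  have int: "integrable torus (\<lambda>x. cos (2 * pi * of_int m * x))"
    "integrable torus (\<lambda>x. sin (2 * pi * of_int m * x))" for m :: int
    by (rule integrable_torus[of _ 1]; simp)+
  note trig = int integral_torus_cos integral_torus_sin
  have cc: "(LINT x|torus. sqrt 2 * cos (2 * pi * of_int m * x) * (sqrt 2 * cos (2 * pi * of_int n * x)))
      = (if m - n = 0 then 1 else 0) + (if m + n = 0 then 1 else 0)" for m n :: int
  proof -
    have "sqrt 2 * cos (2 * pi * of_int m * x) * (sqrt 2 * cos (2 * pi * of_int n * x))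
       = cos (2 * pi * of_int (m - n) * x) + cos (2 * pi * of_int (m + n) * x)" for x
      by (simp add: cos_add cos_diff ring_distribs)
    then show ?thesis by (simp add: trig del: of_int_add of_int_diff)
  qed
  have ss: "(LINT x|torus. sqrt 2 * sin (2 * pi * of_int m * x) * (sqrt 2 * sin (2 * pi * of_int n * x)))
      = (if m - n = 0 then 1 else 0) - (if m + n = 0 then 1 else 0)" for m n :: int
  proof -
    have "sqrt 2 * sin (2 * pi * of_int m * x) * (sqrt 2 * sin (2 * pi * of_int n * x))
       = cos (2 * pi * of_int (m - n) * x) - cos (2 * pi * of_int (m + n) * x)" for x
      by (simp add: cos_add cos_diff ring_distribs)
    then show ?thesis by (simp add: trig del: of_int_add of_int_diff)
  qed
  have cs: "(LINT x|torus. sqrt 2 * cos (2 * pi * of_int m * x) * (sqrt 2 * sin (2 * pi * of_int n * x))) = 0"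
    for m n :: int
  proof -
    have "sqrt 2 * cos (2 * pi * of_int m * x) * (sqrt 2 * sin (2 * pi * of_int n * x))
       = sin (2 * pi * of_int (m + n) * x) - sin (2 * pi * of_int (m - n) * x)" for x
      by (simp add: sin_add sin_diff ring_distribs)
    then show ?thesis by (simp add: trig del: of_int_add of_int_diff)
  qed
  have sc: "(LINT x|torus. sqrt 2 * sin (2 * pi * of_int m * x) * (sqrt 2 * cos (2 * pi * of_int n * x))) = 0"
    for m n :: int
    using cs[of n m] by (simp add: mult_ac)
  have pos: "eigfun i x = sqrt 2 * cos (2 * pi * of_int i * x)" if "1 \<le> i" for i x
    using that by (simp add: eigfun_def)
  have neg: "eigfun i x = sqrt 2 * sin (2 * pi * of_int (- i) * x)" if "i \<le> - 1" for i x
    using that by (simp add: eigfun_def)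
  have "1 \<le> j \<or> j \<le> - 1" "1 \<le> k \<or> k \<le> - 1" using assms by (auto simp: Zstar_def)
  then show ?thesis
    by (elim disjE; simp only: pos neg cc ss cs sc) auto
qed

section \<open>Coefficients and convergence of series in \<open>H\<close>\<close>

text \<open>As soon as \<open>F\<close> contains \<open>k\<close>, the k-th coefficient of the
  remainder is \<open>inner_H x (eigfun k) - c k\<close>, whatever \<open>F\<close> is; it is
  bounded by the norm of the remainder, which tends to 0.\<close>

lemma series_conv_H_coeff:
  assumes conv: "series_conv_H c x" and k: "k \<in> Zstar"
  shows "inner_H x (eigfun k) = c k"
proof -
  interpret prob_space torus by (rule prob_space_torus)
  have [measurable]: "x \<in> borel_measurable torus" and x2: "integrable torus (\<lambda>\<xi>. (x \<xi>)\<^sup>2)"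
    using conv by (auto simp: series_conv_H_def H_def)
  have [measurable]: "eigfun j \<in> borel_measurable torus" for j
    by (intro borel_measurable_torus) simp
  have x1: "integrable torus x" by (rule square_integrable_imp_integrable) (use x2 in auto)
  have xe: "integrable torus (\<lambda>\<xi>. x \<xi> * eigfun j \<xi>)" for j
  proof (rule Bochner_Integration.integrable_bound)
    show "integrable torus (\<lambda>\<xi>. sqrt 2 * x \<xi>)" using x1 by simp
    show "AE \<xi> in torus. norm (x \<xi> * eigfun j \<xi>) \<le> norm (sqrt 2 * x \<xi>)"
      using abs_eigfun_le[of j] by (auto simp: abs_mult mult.commute[of "\<bar>x _\<bar>"] intro!: mult_right_mono)
  qed simp
  define y where "y = (\<lambda>F \<xi>. x \<xi> - (\<Sum>j\<in>F. c j * eigfun j \<xi>))"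
  have le: "\<bar>inner_H x (eigfun k) - c k\<bar> \<le> norm_H (y F)" if F: "finite F" "F \<subseteq> Zstar" "k \<in> F" for F
  proof -
    define S where "S = (\<lambda>\<xi>. \<Sum>j\<in>F. c j * eigfun j \<xi>)"
    have S2: "integrable torus (\<lambda>\<xi>. (S \<xi>)\<^sup>2)"
      unfolding S_def using F
      by (intro integral_square_sum_orthonormal integrable_eigfun_mult orthonormal_eigfun) auto
    have xS: "integrable torus (\<lambda>\<xi>. x \<xi> * S \<xi>)"
      unfolding S_def sum_distrib_left by (intro Bochner_Integration.integrable_sum)
        (use xe in \<open>simp add: mult.left_commute\<close>)
    have yy: "integrable torus (\<lambda>\<xi>. y F \<xi> * y F \<xi>)"
    proof -
      have "(\<lambda>\<xi>. y F \<xi> * y F \<xi>) = (\<lambda>\<xi>. (x \<xi>)\<^sup>2 - 2 * (x \<xi> * S \<xi>) + (S \<xi>)\<^sup>2)"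
        by (auto simp: y_def S_def power2_eq_square algebra_simps)
      then show ?thesis using x2 S2 xS by simp
    qed
    have Se: "integrable torus (\<lambda>\<xi>. S \<xi> * eigfun k \<xi>)"
      unfolding S_def sum_distrib_right mult.assoc
      by (intro Bochner_Integration.integrable_sum integrable_mult_right integrable_eigfun_mult)
    have "(LINT \<xi>|torus. S \<xi> * eigfun k \<xi>) = (\<Sum>j\<in>F. if j = k then c j else 0)"
      unfolding S_def sum_distrib_right mult.assoc using F(2) k
      by (subst Bochner_Integration.integral_sum)
        (auto intro!: sum.cong simp: integrable_eigfun_mult orthonormal_eigfun)
    also have "\<dots> = c k" using F by simp
    finally have Se_eq: "(LINT \<xi>|torus. S \<xi> * eigfun k \<xi>) = c k" .
    have ye_eq: "y F \<xi> * eigfun k \<xi> = x \<xi> * eigfun k \<xi> - S \<xi> * eigfun k \<xi>" for \<xi>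
      by (simp add: y_def S_def algebra_simps)
    define \<mu> where "\<mu> = inner_H x (eigfun k) - c k"
    have ye: "integrable torus (\<lambda>\<xi>. y F \<xi> * eigfun k \<xi>)" "(LINT \<xi>|torus. y F \<xi> * eigfun k \<xi>) = \<mu>"
      unfolding ye_eq \<mu>_def using xe[of k] Se Se_eq by (auto simp: inner_H_def)
    \<comment> \<open>Cauchy-Schwarz against a unit vector: subtracting the projection on
      \<open>eigfun k\<close> from \<open>y F\<close> leaves a nonnegative square norm.\<close>
    have "0 \<le> (LINT \<xi>|torus. (y F \<xi> - \<mu> * eigfun k \<xi>)\<^sup>2)" by simp
    also have "\<dots> = (LINT \<xi>|torus. y F \<xi> * y F \<xi> - 2 * \<mu> * (y F \<xi> * eigfun k \<xi>)
        + \<mu>\<^sup>2 * (eigfun k \<xi> * eigfun k \<xi>))"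
      by (intro Bochner_Integration.integral_cong) (auto simp: power2_eq_square algebra_simps)
    also have "\<dots> = inner_H (y F) (y F) - \<mu>\<^sup>2"
      using yy ye k by (simp add: integrable_eigfun_mult orthonormal_eigfun inner_H_def power2_eq_square)
    finally have "\<mu>\<^sup>2 \<le> inner_H (y F) (y F)" by simp
    then have "sqrt (\<mu>\<^sup>2) \<le> norm_H (y F)" unfolding norm_H_def by (rule real_sqrt_le_mono)
    then show ?thesis by (simp add: \<mu>_def)
  qed
  have "((\<lambda>F. norm_H (y F)) \<longlongrightarrow> 0) (finite_subsets_at_top Zstar)"
    using conv by (simp add: series_conv_H_def y_def)
  moreover have "\<forall>\<^sub>F F in finite_subsets_at_top Zstar. \<bar>inner_H x (eigfun k) - c k\<bar> \<le> norm_H (y F)"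
    unfolding eventually_finite_subsets_at_top
    using k le by (intro exI[of _ "{k}"]) auto
  ultimately have "\<bar>inner_H x (eigfun k) - c k\<bar> \<le> 0"
    by (intro tendsto_lowerbound) auto
  then show ?thesis by simp
qed

lemma countable_infinite_Zstar: "countable Zstar" "infinite Zstar"
proof -
  show "infinite Zstar" by (simp add: Zstar_def infinite_UNIV_int)
qed simp

text \<open>An enumeration of \<open>Zstar\<close> reduces this to \<open>riesz_fischer\<close>; a
  finite set of modes becomes its preimage under the enumeration. What remains for membership in
  \<open>H\<close> is that the limit has mean zero.\<close>

lemma series_conv_H_exists:
  assumes c: "(\<lambda>k. (c k)\<^sup>2) summable_on Zstar"
  shows "\<exists>x. series_conv_H c x"
proof -
  interpret prob_space torus by (rule prob_space_torus)
  have [measurable]: "eigfun j \<in> borel_measurable torus" for j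
    by (intro borel_measurable_torus) simp
  define \<kappa> where "\<kappa> = from_nat_into Zstar"
  have bij: "bij_betw \<kappa> UNIV Zstar"
    unfolding \<kappa>_def using countable_infinite_Zstar by (rule bij_betw_from_nat_into)
  then have \<kappa>: "\<kappa> i \<in> Zstar" "\<kappa> i = \<kappa> j \<longleftrightarrow> i = j" for i j
    by (auto simp: bij_betw_def inj_def)
  have c': "(\<lambda>i. (c (\<kappa> i))\<^sup>2) summable_on UNIV"
    using c summable_on_reindex_bij_betw[OF bij, of "\<lambda>k. (c k)\<^sup>2"] by simp
  then have summ: "summable (\<lambda>i. (c (\<kappa> i))\<^sup>2)"
    by (rule summable_on_imp_summable)
  obtain x where x [measurable]: "x \<in> borel_measurable torus"
    and le: "\<And>F. finite F \<Longrightarrow> (\<integral>\<^sup>+\<xi>. ennreal ((x \<xi> - (\<Sum>i\<in>F. c (\<kappa> i) * eigfun (\<kappa> i) \<xi>))\<^sup>2) \<partial>torus)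
      \<le> ennreal ((\<Sum>i. (c (\<kappa> i))\<^sup>2) - (\<Sum>i\<in>F. (c (\<kappa> i))\<^sup>2))"
    by (rule riesz_fischer[of "\<lambda>i. eigfun (\<kappa> i)" "\<lambda>i. c (\<kappa> i)"])
      (use summ \<kappa> in \<open>auto simp: integrable_eigfun_mult orthonormal_eigfun\<close>)
  define total where "total = (\<Sum>\<^sub>\<infinity>k\<in>Zstar. (c k)\<^sup>2)"
  have total: "(\<Sum>i. (c (\<kappa> i))\<^sup>2) = total"
  proof -
    have "total = (\<Sum>\<^sub>\<infinity>i. (c (\<kappa> i))\<^sup>2)"
      unfolding total_def by (rule infsum_reindex_bij_betw[OF bij, symmetric])
    then show ?thesis using c' by (metis has_sum_imp_sums has_sum_infsum sums_unique)
  qed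
  define y where "y = (\<lambda>F \<xi>. x \<xi> - (\<Sum>k\<in>F. c k * eigfun k \<xi>))"
  have y: "integrable torus (\<lambda>\<xi>. (y F \<xi>)\<^sup>2)" "(LINT \<xi>|torus. (y F \<xi>)\<^sup>2) \<le> total - (\<Sum>k\<in>F. (c k)\<^sup>2)"
    if F: "finite F" "F \<subseteq> Zstar" for F
  proof -
    define G where "G = \<kappa> -` F"
    have FG: "F = \<kappa> ` G" using bij F by (auto simp: G_def bij_betw_def)
    have G: "finite G" "inj_on \<kappa> G"
      unfolding G_def using bij F(1)
      by (auto simp: bij_betw_def intro!: finite_vimageI intro: inj_on_subset)
    have [measurable]: "y F \<in> borel_measurable torus" unfolding y_def by measurable
    have nonneg: "0 \<le> total - (\<Sum>k\<in>F. (c k)\<^sup>2)"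
      using F c unfolding total_def by (simp add: finite_sum_le_infsum)
    have *: "(\<integral>\<^sup>+\<xi>. ennreal ((y F \<xi>)\<^sup>2) \<partial>torus) \<le> ennreal (total - (\<Sum>k\<in>F. (c k)\<^sup>2))"
      using le[OF G(1)] G(2) by (simp add: y_def FG sum.reindex total)
    then show int: "integrable torus (\<lambda>\<xi>. (y F \<xi>)\<^sup>2)"
      by (intro integrableI_bounded) (auto intro: le_less_trans)
    then show "(LINT \<xi>|torus. (y F \<xi>)\<^sup>2) \<le> total - (\<Sum>k\<in>F. (c k)\<^sup>2)"
      using * nonneg by (simp add: nn_integral_eq_integral)
  qed
  have norm_sq: "(norm_H (y F))\<^sup>2 = (LINT \<xi>|torus. (y F \<xi>)\<^sup>2)" for F
    by (simp add: norm_H_def inner_H_def power2_eq_square)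
  have "((\<lambda>F. total - (\<Sum>k\<in>F. (c k)\<^sup>2)) \<longlongrightarrow> total - total) (finite_subsets_at_top Zstar)"
    using has_sum_infsum[OF c] by (intro tendsto_intros) (simp add: has_sum_def total_def)
  then have upper: "((\<lambda>F. total - (\<Sum>k\<in>F. (c k)\<^sup>2)) \<longlongrightarrow> 0) (finite_subsets_at_top Zstar)"
    by simp
  have "((\<lambda>F. (norm_H (y F))\<^sup>2) \<longlongrightarrow> 0) (finite_subsets_at_top Zstar)"
    by (rule tendsto_sandwich[OF _ _ tendsto_const upper])
      (simp_all add: eventually_finite_subsets_at_top_weakI y(2) norm_sq)
  then have lim: "((\<lambda>F. norm_H (y F)) \<longlongrightarrow> 0) (finite_subsets_at_top Zstar)"
    using tendsto_real_sqrt[of "\<lambda>F. (norm_H (y F))\<^sup>2" 0] by (simp add: norm_H_def inner_H_def)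
  have x2: "integrable torus (\<lambda>\<xi>. (x \<xi>)\<^sup>2)" using y(1)[of "{}"] by (simp add: y_def)
  have x1: "integrable torus x" by (rule square_integrable_imp_integrable) (use x2 in auto)
  \<comment> \<open>The eigenfunctions have mean zero, so \<open>x\<close> and every remainder
    \<open>y F\<close> have the same mean. Nonnegativity of the variance bounds it by the norm of
    \<open>y F\<close>, which vanishes in the limit.\<close>
  have mean: "\<bar>LINT \<xi>|torus. x \<xi>\<bar> \<le> norm_H (y F)" if F: "finite F" "F \<subseteq> Zstar" for F
  proof -
    have y_meas: "y F \<in> borel_measurable torus" unfolding y_def by measurable
    have y1: "integrable torus (y F)" by (rule square_integrable_imp_integrable[OF y_meas y(1)[OF F]])
    have "(LINT \<xi>|torus. y F \<xi>) = (LINT \<xi>|torus. x \<xi>) - (\<Sum>k\<in>F. c k * (LINT \<xi>|torus. eigfun k \<xi>))"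
      unfolding y_def using x1 by (simp add: Bochner_Integration.integral_sum integrable_eigfun)
    also have "\<dots> = (LINT \<xi>|torus. x \<xi>)" using F(2) by (simp add: integral_eigfun subset_iff)
    finally have "(LINT \<xi>|torus. x \<xi>)\<^sup>2 = (expectation (y F))\<^sup>2" by simp
    also have "\<dots> \<le> (norm_H (y F))\<^sup>2"
      using variance_positive[of "y F"] variance_eq[OF y1 y(1)[OF F]] by (simp add: norm_sq)
    finally have "\<bar>LINT \<xi>|torus. x \<xi>\<bar> \<le> \<bar>norm_H (y F)\<bar>" by (simp add: abs_le_square_iff)
    then show ?thesis by (simp add: norm_H_def inner_H_def)
  qed
  have "\<bar>LINT \<xi>|torus. x \<xi>\<bar> \<le> 0"
    by (rule tendsto_lowerbound[OF lim]) (auto intro!: eventually_finite_subsets_at_top_weakI mean)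
  then have "series_conv_H c x"
    using lim x2 x unfolding series_conv_H_def y_def by (simp add: H_def)
  then show ?thesis by blast
qed

lemma infsum_ennreal_SUP:
  "(\<Sum>\<^sub>\<infinity>k\<in>A. f k :: ennreal) = (SUP F\<in>{F. finite F \<and> F \<subseteq> A}. \<Sum>k\<in>F. f k)"
  by (rule nonneg_infsum_complete) simp

lemma summable_on_real_if_infsum_ennreal:
  assumes "\<And>k. k \<in> A \<Longrightarrow> 0 \<le> f k" and fin: "(\<Sum>\<^sub>\<infinity>k\<in>A. ennreal (f k)) \<noteq> \<infinity>"
  shows "f summable_on A"
proof (rule nonneg_bdd_above_summable_on)
  obtain B where B: "(\<Sum>\<^sub>\<infinity>k\<in>A. ennreal (f k)) = ennreal B" "0 \<le> B"
    using fin by (cases "\<Sum>\<^sub>\<infinity>k\<in>A. ennreal (f k)") auto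
  show "bdd_above (sum f ` {F. F \<subseteq> A \<and> finite F})"
  proof (rule bdd_aboveI2)
    fix F assume F: "F \<in> {F. F \<subseteq> A \<and> finite F}"
    then have "ennreal (sum f F) = (\<Sum>k\<in>F. ennreal (f k))"
      using assms(1) by (subst sum_ennreal) auto
    also have "\<dots> \<le> ennreal B"
      unfolding B(1)[symmetric] infsum_ennreal_SUP using F by (intro SUP_upper) auto
    finally show "sum f F \<le> B" using B(2) by simp
  qed
qed (use assms in auto)

lemma eigval_ge_1: "k \<in> Zstar \<Longrightarrow> 1 \<le> eigval k"
proof -
  assume "k \<in> Zstar"
  then have "1 \<le> \<bar>real_of_int k\<bar>" by (auto simp: Zstar_def)
  then have "1 \<le> \<bar>real_of_int k\<bar>\<^sup>2" by (rule one_le_power)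
  moreover have "1 \<le> 4 * pi\<^sup>2" using one_le_power[of pi 2] pi_gt3 by linarith
  ultimately have "1 * 1 \<le> (4 * pi\<^sup>2) * \<bar>real_of_int k\<bar>\<^sup>2"
    by (intro mult_mono) auto
  then show ?thesis by (simp add: eigval_def)
qed

text \<open>If the series diverges in \<open>H\<close>, both sides are \<open>\<infinity>\<close>.\<close>

lemma norm_A_pow_ext_series_H:
  assumes "0 \<le> \<theta>"
  shows "norm_A_pow_ext \<theta> (series_H c)
    = epowr (\<Sum>\<^sub>\<infinity>k\<in>Zstar. ennreal (eigval k powr (2 * \<theta>) * (c k)\<^sup>2)) (1 / 2)"
proof (cases "\<exists>x. series_conv_H c x")
  case True
  then have "series_conv_H c (SOME x. series_conv_H c x)" by (rule someI_ex)
  then show ?thesis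
    using True by (simp add: norm_A_pow_ext_def series_H_def norm_A_pow_def series_conv_H_coeff cong: infsum_cong)
next
  case False
  then have "\<not> (\<lambda>k. (c k)\<^sup>2) summable_on Zstar" using series_conv_H_exists by blast
  then have "\<infinity> = (\<Sum>\<^sub>\<infinity>k\<in>Zstar. ennreal ((c k)\<^sup>2))"
    using summable_on_real_if_infsum_ennreal[of Zstar "\<lambda>k. (c k)\<^sup>2"] by fastforce
  \<comment> \<open>Divergence survives the weights, which are at least 1 since \<gamma>_k \<ge> 1
    and \<theta> \<ge> 0.\<close>
  also have "\<dots> \<le> (\<Sum>\<^sub>\<infinity>k\<in>Zstar. ennreal (eigval k powr (2 * \<theta>) * (c k)\<^sup>2))"
  proof (rule infsum_mono)
    fix k assume "k \<in> Zstar"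
    then have "1 \<le> eigval k powr (2 * \<theta>)" using eigval_ge_1 assms by (simp add: ge_one_powr_ge_zero)
    then show "ennreal ((c k)\<^sup>2) \<le> ennreal (eigval k powr (2 * \<theta>) * (c k)\<^sup>2)"
      by (intro ennreal_leI) (metis mult_1 mult_right_mono zero_le_power2)
  qed (auto intro: nonneg_summable_on_complete)
  finally have "(\<Sum>\<^sub>\<infinity>k\<in>Zstar. ennreal (eigval k powr (2 * \<theta>) * (c k)\<^sup>2)) = \<infinity>"
    by (simp add: top_unique)
  then show ?thesis using False by (simp add: norm_A_pow_ext_def series_H_def epowr_def)
qed

section \<open>Tails of suprema of stable processes\<close>

text \<open>Locates the dyadic scale of a number; every layer argument below uses it to select the
  one term of a geometric series that does the work.\<close>

lemma dyadic_bracket: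
  fixes r :: real
  assumes "1 \<le> r"
  obtains n where "2 ^ n \<le> r" "r < 2 ^ Suc n"
proof -
  obtain m where m: "r < 2 ^ m" using real_arch_pow[of 2 r] by auto
  define k where "k = (LEAST m. r < 2 ^ m)"
  have k: "r < 2 ^ k" unfolding k_def using m by (rule LeastI)
  then obtain n where n: "k = Suc n" using assms by (cases k) auto
  have "\<not> r < 2 ^ n" using not_less_Least[of n "\<lambda>m. r < 2 ^ m"] n by (simp add: k_def)
  then show thesis using that[of n] k n by simp
qed

text \<open>The value of the geometric series of (\<pi>/2 / 2^j)^\<alpha> over all j, which arises
  when characteristic function bounds at the frequencies \<pi>/(2 x) / 2^j are added up.\<close>

definition stable_tail_const :: "real \<Rightarrow> real" where
  "stable_tail_const \<alpha> = (pi / 2) powr \<alpha> / (1 - 2 powr - \<alpha>)"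

lemma stable_tail_const_nonneg: "0 < \<alpha> \<Longrightarrow> 0 \<le> stable_tail_const \<alpha>"
  unfolding stable_tail_const_def by (simp add: powr_minus inverse_le_1_iff ge_one_powr_ge_zero)

lemma dyadic_powr_sums:
  fixes a c x :: real
  assumes "0 < a" "0 \<le> x" "0 \<le> c"
  shows "(\<lambda>j. c * (x / 2 ^ j) powr a) sums (c * x powr a / (1 - 2 powr - a))"
proof -
  have "(x / 2 ^ j) powr a = x powr a * (2 powr - a) ^ j" for j
  proof -
    have "(2 ^ j) powr a = (2 powr a) ^ j"
      by (simp add: powr_powr mult.commute flip: powr_realpow)
    then show ?thesis
      using assms by (simp add: powr_divide powr_minus_divide power_divide)
  qed
  moreover have "(\<lambda>j. (c * x powr a) * (2 powr - a) ^ j) sums ((c * x powr a) * (1 / (1 - 2 powr - a)))"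
    using assms powr_less_mono[of "- a" 0 2] by (intro sums_mult geometric_sums) simp
  ultimately show ?thesis by (simp add: mult_ac)
qed

text \<open>If \<open>\<bar>X\<bar> \<ge> x\<close>, some dyadic scaling of \<open>\<pi> X / (2 x)\<close> has modulus in \<open>[\<pi>/2, \<pi>)\<close>, where
  \<open>1 - cos \<ge> 1\<close>.\<close>

lemma (in prob_space) stable_tail:
  fixes X :: "'a \<Rightarrow> real"
  assumes [measurable]: "X \<in> borel_measurable M"
    and char: "\<And>u. char (distr M borel X) u = complex_of_real (exp (- t * \<bar>u\<bar> powr \<alpha>))"
    and "0 \<le> t" "0 < \<alpha>" "0 < x"
  shows "prob {\<omega> \<in> space M. x \<le> \<bar>X \<omega>\<bar>} \<le> stable_tail_const \<alpha> * t * x powr - \<alpha>"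
proof -
  have cos_int: "integrable M (\<lambda>\<omega>. cos (u * X \<omega>))" for u
    by (intro integrable_const_bound[of _ 1]) auto
  have cos_eq: "expectation (\<lambda>\<omega>. cos (u * X \<omega>)) = exp (- t * \<bar>u\<bar> powr \<alpha>)" for u
  proof -
    have "integrable M (\<lambda>\<omega>. iexp (u * X \<omega>))"
      by (intro integrable_const_bound[of _ 1]) auto
    then have "Re (CLINT \<omega>|M. iexp (u * X \<omega>)) = expectation (\<lambda>\<omega>. Re (iexp (u * X \<omega>)))"
      by (rule integral_Re[symmetric])
    also have "(CLINT \<omega>|M. iexp (u * X \<omega>)) = char (distr M borel X) u"
      unfolding char_def by (subst integral_distr) auto
    finally show ?thesis by (simp add: char Re_exp)
  qed
  have term_le: "(\<integral>\<^sup>+\<omega>. ennreal (1 - cos (u * X \<omega>)) \<partial>M) \<le> ennreal (t * \<bar>u\<bar> powr \<alpha>)" for u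
  proof -
    have "(\<integral>\<^sup>+\<omega>. ennreal (1 - cos (u * X \<omega>)) \<partial>M) = ennreal (1 - exp (- t * \<bar>u\<bar> powr \<alpha>))"
      using cos_int[of u] by (subst nn_integral_eq_integral) (auto simp: cos_eq prob_space)
    also have "1 - exp (- t * \<bar>u\<bar> powr \<alpha>) \<le> t * \<bar>u\<bar> powr \<alpha>"
      using exp_ge_add_one_self[of "- t * \<bar>u\<bar> powr \<alpha>"] by simp
    finally show ?thesis by (simp add: ennreal_leI)
  qed
  define u where "u = (\<lambda>j. pi / (2 * x) / 2 ^ j :: real)"
  have "emeasure M {\<omega> \<in> space M. x \<le> \<bar>X \<omega>\<bar>} = (\<integral>\<^sup>+\<omega>. indicator {\<omega> \<in> space M. x \<le> \<bar>X \<omega>\<bar>} \<omega> \<partial>M)"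
    by simp
  \<comment> \<open>The good scale \<open>n\<close> depends on \<omega>. Summing over all scales
    removes this dependence: every term is nonnegative, and one term of size at least 1
    suffices.\<close>
  also have "\<dots> \<le> (\<integral>\<^sup>+\<omega>. (\<Sum>j. ennreal (1 - cos (u j * X \<omega>))) \<partial>M)"
  proof (rule nn_integral_mono)
    fix \<omega> assume "\<omega> \<in> space M"
    show "indicator {\<omega> \<in> space M. x \<le> \<bar>X \<omega>\<bar>} \<omega> \<le> (\<Sum>j. ennreal (1 - cos (u j * X \<omega>)))"
    proof (cases "x \<le> \<bar>X \<omega>\<bar>")
      case True
      then obtain n where n: "2 ^ n \<le> \<bar>X \<omega>\<bar> / x" "\<bar>X \<omega>\<bar> / x < 2 ^ Suc n"
        using dyadic_bracket[of "\<bar>X \<omega>\<bar> / x"] \<open>0 < x\<close> by auto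
      define v where "v = u n * \<bar>X \<omega>\<bar>"
      have v_eq: "v = pi / 2 * (\<bar>X \<omega>\<bar> / x / 2 ^ n)" by (simp add: v_def u_def)
      define w where "w = \<bar>X \<omega>\<bar> / x"
      have "1 \<le> \<bar>X \<omega>\<bar> / x / 2 ^ n" "\<bar>X \<omega>\<bar> / x / 2 ^ n \<le> 2"
        using n unfolding w_def[symmetric] by (simp_all add: field_simps)
      then have "pi / 2 * 1 \<le> v" "v \<le> pi / 2 * 2" unfolding v_eq by (intro mult_left_mono; simp)+
      then have "0 \<le> sin (v - pi / 2)" by (intro sin_ge_zero) auto
      then have "cos v \<le> 0" by (simp add: sin_diff)
      moreover have "cos v = cos (u n * X \<omega>)" unfolding v_def by (auto simp: abs_if)
      ultimately have "1 \<le> ennreal (1 - cos (u n * X \<omega>))" by simp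
      also have "\<dots> = (\<Sum>j\<in>{n}. ennreal (1 - cos (u j * X \<omega>)))" by simp
      also have "\<dots> \<le> (\<Sum>j. ennreal (1 - cos (u j * X \<omega>)))" by (intro sum_le_suminf) auto
      finally show ?thesis by (auto simp: indicator_def)
    qed simp
  qed
  also have "\<dots> = (\<Sum>j. \<integral>\<^sup>+\<omega>. ennreal (1 - cos (u j * X \<omega>)) \<partial>M)"
    by (intro nn_integral_suminf) auto
  also have "\<dots> \<le> (\<Sum>j. ennreal (t * \<bar>u j\<bar> powr \<alpha>))"
    by (intro suminf_le term_le) auto
  also have "\<dots> = ennreal (stable_tail_const \<alpha> * t * x powr - \<alpha>)"
  proof -
    have "(\<lambda>j. t * \<bar>u j\<bar> powr \<alpha>) sums (t * (pi / (2 * x)) powr \<alpha> / (1 - 2 powr - \<alpha>))"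
      using dyadic_powr_sums[of \<alpha> "pi / (2 * x)" t] assms by (simp add: u_def)
    moreover have "t * (pi / (2 * x)) powr \<alpha> / (1 - 2 powr - \<alpha>) = stable_tail_const \<alpha> * t * x powr - \<alpha>"
      using \<open>0 < x\<close> by (simp add: stable_tail_const_def powr_divide powr_mult powr_minus field_simps)
    ultimately show ?thesis
      using \<open>0 \<le> t\<close> by (auto intro!: suminf_ennreal_eq)
  qed
  finally show ?thesis
    using assms stable_tail_const_nonneg[of \<alpha>] by (simp add: emeasure_eq_measure)
qed

text \<open>Etemadi's argument: decompose according to the first index \<open>j\<close> at which the partial sums exceed
  \<open>3 x\<close>; that event is independent of the remaining increments.\<close>

lemma (in prob_space) partial_sums_maximal_inequality:
  fixes \<xi> :: "nat \<Rightarrow> 'a \<Rightarrow> real"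
  assumes indep: "indep_vars (\<lambda>_. borel) \<xi> {..<n}"
    and total: "prob {\<omega> \<in> space M. \<bar>\<Sum>i<n. \<xi> i \<omega>\<bar> \<ge> x} \<le> q"
    and rest: "\<And>j. j \<le> n \<Longrightarrow> prob {\<omega> \<in> space M. \<bar>\<Sum>i\<in>{j..<n}. \<xi> i \<omega>\<bar> \<ge> 2 * x} \<le> r"
  shows "prob {\<omega> \<in> space M. \<exists>j\<le>n. 3 * x < \<bar>\<Sum>i<j. \<xi> i \<omega>\<bar>} \<le> q + r"
proof -
  have [measurable]: "\<xi> i \<in> borel_measurable M" if "i < n" for i
    using indep that by (auto simp: indep_vars_def)
  define S where "S = (\<lambda>j \<omega>. \<Sum>i<j. \<xi> i \<omega>)"
  have S [measurable]: "S j \<in> borel_measurable M" if "j \<le> n" for j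
    unfolding S_def using that by (intro borel_measurable_sum) auto
  define E where "E = (\<lambda>j. {\<omega> \<in> space M. (\<forall>i<j. \<bar>S i \<omega>\<bar> \<le> 3 * x) \<and> 3 * x < \<bar>S j \<omega>\<bar>})"
  define R where "R = (\<lambda>j. {\<omega> \<in> space M. \<bar>\<Sum>i\<in>{j..<n}. \<xi> i \<omega>\<bar> \<ge> 2 * x})"
  define B where "B = {\<omega> \<in> space M. \<bar>\<Sum>i<n. \<xi> i \<omega>\<bar> \<ge> x}"
  have E_sets: "E j \<in> events" if "j \<le> n" for j
  proof -
    have "{\<omega> \<in> space M. \<bar>S i \<omega>\<bar> \<le> 3 * x} \<in> events" if "i \<le> n" for i
      using that by measurable
    then have "{\<omega> \<in> space M. \<forall>i\<in>{..<j}. \<bar>S i \<omega>\<bar> \<le> 3 * x} \<in> events"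
      using that by (intro sets.sets_Collect_finite_All) auto
    moreover have "{\<omega> \<in> space M. 3 * x < \<bar>S j \<omega>\<bar>} \<in> events"
      using that by measurable
    moreover have "E j = {\<omega> \<in> space M. \<forall>i\<in>{..<j}. \<bar>S i \<omega>\<bar> \<le> 3 * x} \<inter> {\<omega> \<in> space M. 3 * x < \<bar>S j \<omega>\<bar>}"
      by (auto simp: E_def)
    ultimately show ?thesis by simp
  qed
  have R_sets: "R j \<in> events" for j unfolding R_def by measurable
  have B_sets: "B \<in> events" unfolding B_def by measurable
  have disj: "disjoint_family_on E {..n}"
    unfolding disjoint_family_on_def
  proof (intro ballI impI)
    fix a b :: nat assume "a \<noteq> b"
    have "E a \<inter> E b = {}" if "a < b" for a b using that by (force simp: E_def)
    then show "E a \<inter> E b = {}" using \<open>a \<noteq> b\<close> by (metis Int_commute linorder_neqE_nat)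
  qed
  have union: "{\<omega> \<in> space M. \<exists>j\<le>n. 3 * x < \<bar>\<Sum>i<j. \<xi> i \<omega>\<bar>} = (\<Union>j\<in>{..n}. E j)"
  proof (intro equalityI subsetI)
    fix \<omega> assume "\<omega> \<in> {\<omega> \<in> space M. \<exists>j\<le>n. 3 * x < \<bar>\<Sum>i<j. \<xi> i \<omega>\<bar>}"
    then obtain j where j: "\<omega> \<in> space M" "j \<le> n" "3 * x < \<bar>S j \<omega>\<bar>" by (auto simp: S_def)
    define k where "k = (LEAST k. 3 * x < \<bar>S k \<omega>\<bar>)"
    have "3 * x < \<bar>S k \<omega>\<bar>" "k \<le> j" unfolding k_def using j(3) by (auto intro: LeastI Least_le)
    moreover have "\<bar>S i \<omega>\<bar> \<le> 3 * x" if "i < k" for i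
      using not_less_Least[of i "\<lambda>k. 3 * x < \<bar>S k \<omega>\<bar>"] that by (simp add: k_def)
    ultimately show "\<omega> \<in> (\<Union>j\<in>{..n}. E j)"
      using j by (intro UN_I[of k]) (auto simp: E_def)
  qed (auto simp: E_def S_def)
  have indep_ER: "prob (E j \<inter> R j) = prob (E j) * prob (R j)" if "j \<le> n" for j
  proof -
    \<comment> \<open>Independence of disjoint blocks is available for the restricted families as
      elements of product spaces; \<open>Q\<close> and \<open>W\<close> are the events there whose
      preimages are \<open>E j\<close> and \<open>R j\<close>.\<close>
    define Q where "Q = {f \<in> space (Pi\<^sub>M {..<j} (\<lambda>_. borel)). (\<forall>i<j. \<bar>\<Sum>k<i. f k\<bar> \<le> 3 * x) \<and> 3 * x < \<bar>\<Sum>k<j. f k :: real\<bar>}"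
    define W where "W = {f \<in> space (Pi\<^sub>M {j..<n} (\<lambda>_. borel)). \<bar>\<Sum>k\<in>{j..<n}. f k :: real\<bar> \<ge> 2 * x}"
    have sum_meas: "(\<lambda>f. \<Sum>k<i. f k :: real) \<in> borel_measurable (Pi\<^sub>M {..<j} (\<lambda>_. borel))" if "i \<le> j" for i
      using that by (intro borel_measurable_sum measurable_component_singleton) auto
    have "Q = {f \<in> space (Pi\<^sub>M {..<j} (\<lambda>_. borel)). \<forall>i\<in>{..<j}. \<bar>\<Sum>k<i. f k\<bar> \<le> 3 * x}
        \<inter> {f \<in> space (Pi\<^sub>M {..<j} (\<lambda>_. borel)). 3 * x < \<bar>\<Sum>k<j. f k :: real\<bar>}"
      by (auto simp: Q_def)
    moreover have "{f \<in> space (Pi\<^sub>M {..<j} (\<lambda>_. borel)). \<bar>\<Sum>k<i. f k\<bar> \<le> 3 * x} \<in> sets (Pi\<^sub>M {..<j} (\<lambda>_. borel))"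
      if "i < j" for i
    proof -
      note [measurable] = sum_meas[OF less_imp_le[OF that]]
      show ?thesis by measurable
    qed
    moreover have "{f \<in> space (Pi\<^sub>M {..<j} (\<lambda>_. borel)). 3 * x < \<bar>\<Sum>k<j. f k :: real\<bar>} \<in> sets (Pi\<^sub>M {..<j} (\<lambda>_. borel))"
    proof -
      note [measurable] = sum_meas[OF order_refl]
      show ?thesis by measurable
    qed
    ultimately have Q: "Q \<in> sets (Pi\<^sub>M {..<j} (\<lambda>_. borel))"
      by (auto intro!: sets.Int sets.sets_Collect_finite_All)
    have W: "W \<in> sets (Pi\<^sub>M {j..<n} (\<lambda>_. borel))" unfolding W_def by measurable
    have "indep_var (Pi\<^sub>M {..<j} (\<lambda>_. borel)) (\<lambda>\<omega>. restrict (\<lambda>i. \<xi> i \<omega>) {..<j})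
        (Pi\<^sub>M {j..<n} (\<lambda>_. borel)) (\<lambda>\<omega>. restrict (\<lambda>i. \<xi> i \<omega>) {j..<n})"
      using that by (intro indep_var_restrict[OF indep]) auto
    from indep_varD[OF this Q W]
    have "prob ((\<lambda>\<omega>. (restrict (\<lambda>i. \<xi> i \<omega>) {..<j}, restrict (\<lambda>i. \<xi> i \<omega>) {j..<n})) -` (Q \<times> W) \<inter> space M)
      = prob ((\<lambda>\<omega>. restrict (\<lambda>i. \<xi> i \<omega>) {..<j}) -` Q \<inter> space M)
        * prob ((\<lambda>\<omega>. restrict (\<lambda>i. \<xi> i \<omega>) {j..<n}) -` W \<inter> space M)" .
    moreover have EQ: "(\<lambda>\<omega>. restrict (\<lambda>i. \<xi> i \<omega>) {..<j}) -` Q \<inter> space M = E j"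
    proof -
      have "(\<Sum>k<i. restrict (\<lambda>i. \<xi> i \<omega>) {..<j} k) = S i \<omega>" if "i \<le> j" for i \<omega>
        unfolding S_def using that by (intro sum.cong) auto
      then show ?thesis by (auto simp: Q_def E_def space_PiM)
    qed
    moreover have RW: "(\<lambda>\<omega>. restrict (\<lambda>i. \<xi> i \<omega>) {j..<n}) -` W \<inter> space M = R j"
    proof -
      have "(\<Sum>k\<in>{j..<n}. restrict (\<lambda>i. \<xi> i \<omega>) {j..<n} k) = (\<Sum>k\<in>{j..<n}. \<xi> k \<omega>)" for \<omega>
        by (intro sum.cong) auto
      then show ?thesis by (auto simp: W_def R_def space_PiM)
    qed
    moreover have "(\<lambda>\<omega>. (restrict (\<lambda>i. \<xi> i \<omega>) {..<j}, restrict (\<lambda>i. \<xi> i \<omega>) {j..<n})) -` (Q \<times> W) \<inter> space M = E j \<inter> R j"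
      unfolding EQ[symmetric] RW[symmetric] by auto
    ultimately show ?thesis by simp
  qed
  \<comment> \<open>If the partial sum at j exceeds 3 x in modulus while the total stays below x,
    the remaining increments must add up to more than 2 x.\<close>
  have sub: "(\<Union>j\<in>{..n}. E j) \<subseteq> B \<union> (\<Union>j\<in>{..n}. E j \<inter> R j)"
  proof
    fix \<omega> assume "\<omega> \<in> (\<Union>j\<in>{..n}. E j)"
    then obtain j where j: "j \<le> n" "\<omega> \<in> E j" by auto
    have "(\<Sum>i<n. \<xi> i \<omega>) = S j \<omega> + (\<Sum>i\<in>{j..<n}. \<xi> i \<omega>)"
      unfolding S_def using j(1) sum.atLeastLessThan_concat[of 0 j n "\<lambda>i. \<xi> i \<omega>"]
      by (simp add: atLeast0LessThan)
    then show "\<omega> \<in> B \<union> (\<Union>j\<in>{..n}. E j \<inter> R j)"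
      using j by (auto simp: B_def R_def E_def)
  qed
  have "prob (\<Union>j\<in>{..n}. E j) \<le> prob (B \<union> (\<Union>j\<in>{..n}. E j \<inter> R j))"
    using sub B_sets E_sets R_sets by (intro finite_measure_mono) auto
  also have "\<dots> \<le> prob B + prob (\<Union>j\<in>{..n}. E j \<inter> R j)"
    using B_sets E_sets R_sets by (intro measure_Un_le) auto
  also have "prob (\<Union>j\<in>{..n}. E j \<inter> R j) \<le> (\<Sum>j\<le>n. prob (E j \<inter> R j))"
    using E_sets R_sets by (intro finite_measure_subadditive_finite) auto
  \<comment> \<open>As the events \<open>E j\<close> are disjoint, these bounds add up to a single
    \<open>r\<close> instead of one for each j; the estimate is thus free of
    \<open>n\<close>.\<close>
  also have "\<dots> \<le> (\<Sum>j\<le>n. prob (E j) * r)"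
    using indep_ER rest by (intro sum_mono) (auto simp: R_def intro!: mult_left_mono)
  also have "\<dots> = prob (\<Union>j\<in>{..n}. E j) * r"
    using E_sets disj by (subst finite_measure_finite_Union) (auto simp: sum_distrib_right)
  also have "\<dots> \<le> 1 * r"
    using rest[of n] by (intro mult_right_mono) (auto intro: order_trans[OF measure_nonneg])
  finally show ?thesis
    using total unfolding union B_def by simp
qed

lemma (in prob_space) stable_increment_tail:
  assumes X: "sym_stable_process \<alpha> X" and "0 < \<alpha>" "0 \<le> s" "s \<le> t" "0 < x"
  shows "prob {\<omega> \<in> space M. x \<le> \<bar>X t \<omega> - X s \<omega>\<bar>} \<le> stable_tail_const \<alpha> * (t - s) * x powr - \<alpha>"
proof (rule stable_tail)
  have meas: "X u \<in> borel_measurable M" if "0 \<le> u" for u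
    using X that by (simp add: sym_stable_process_def)
  show "(\<lambda>\<omega>. X t \<omega> - X s \<omega>) \<in> borel_measurable M"
    using meas assms by (intro borel_measurable_diff) auto
  have "\<forall>s\<ge>0. \<forall>h\<ge>0. distr M borel (\<lambda>\<omega>. X (s + h) \<omega> - X s \<omega>) = distr M borel (X h)"
    using X by (simp add: sym_stable_process_def)
  then have "distr M borel (\<lambda>\<omega>. X (s + (t - s)) \<omega> - X s \<omega>) = distr M borel (X (t - s))"
    using assms by (metis diff_ge_0_iff_ge)
  then show "char (distr M borel (\<lambda>\<omega>. X t \<omega> - X s \<omega>)) u
      = complex_of_real (exp (- (t - s) * \<bar>u\<bar> powr \<alpha>))" for u
    using X assms by (simp add: sym_stable_process_def algebra_simps)
qed (use assms in auto)

text \<open>The total and every remaining increment run over a time of at most T, and (2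
  x)^(-\<alpha>) \<le> x^(-\<alpha>), so both terms of the maximal inequality have the same bound,
  whence the factor 2. Nothing depends on the number of grid points.\<close>

lemma (in prob_space) stable_grid_tail:
  assumes X: "sym_stable_process \<alpha> X" and "0 < \<alpha>" "0 \<le> T" "0 < x" "0 < n"
  shows "prob {\<omega> \<in> space M. \<exists>j\<le>n. 3 * x < \<bar>X (T * real j / real n) \<omega>\<bar>}
    \<le> 2 * stable_tail_const \<alpha> * T * x powr - \<alpha>"
proof -
  define s where "s = (\<lambda>i. T * real i / real n)"
  define \<xi> where "\<xi> = (\<lambda>i \<omega>. X (s (Suc i)) \<omega> - X (s i) \<omega>)"
  have [measurable]: "X (s i) \<in> borel_measurable M" for i
    using X \<open>0 \<le> T\<close> by (simp add: sym_stable_process_def s_def)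
  have s_mono: "s i \<le> s j" if "i \<le> j" for i j
    using that \<open>0 \<le> T\<close> by (simp add: s_def divide_right_mono mult_left_mono)
  have s0: "s 0 = 0" and sn: "s n = T" using \<open>0 < n\<close> by (simp_all add: s_def)
  let ?K = "stable_tail_const \<alpha> * T * x powr - \<alpha>"
  have K: "0 \<le> stable_tail_const \<alpha>" using assms by (intro stable_tail_const_nonneg) auto
  have indep: "indep_vars (\<lambda>_. borel) \<xi> {..<n}"
    using X s_mono s0 unfolding sym_stable_process_def \<xi>_def by auto
  have part: "(\<Sum>i\<in>{j..<n}. \<xi> i \<omega>) = X T \<omega> - X (s j) \<omega>" if "j \<le> n" for j \<omega>
    using that sum_Suc_diff'[of j n "\<lambda>i. X (s i) \<omega>"] by (simp add: \<xi>_def sn)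
  have init: "(\<Sum>i<j. \<xi> i \<omega>) = X (s j) \<omega> - X 0 \<omega>" for j \<omega>
    using sum_lessThan_telescope[of "\<lambda>i. X (s i) \<omega>" j] by (simp add: \<xi>_def s0)
  have "prob {\<omega> \<in> space M. \<exists>j\<le>n. 3 * x < \<bar>\<Sum>i<j. \<xi> i \<omega>\<bar>} \<le> ?K + ?K"
  proof (rule partial_sums_maximal_inequality[OF indep])
    show "prob {\<omega> \<in> space M. x \<le> \<bar>\<Sum>i<n. \<xi> i \<omega>\<bar>} \<le> ?K"
      using stable_increment_tail[OF X \<open>0 < \<alpha>\<close>, of 0 T x] assms by (simp add: init sn)
    fix j assume j: "j \<le> n"
    have "prob {\<omega> \<in> space M. 2 * x \<le> \<bar>X T \<omega> - X (s j) \<omega>\<bar>}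
        \<le> stable_tail_const \<alpha> * (T - s j) * (2 * x) powr - \<alpha>"
      using stable_increment_tail[OF X \<open>0 < \<alpha>\<close>, of "s j" T "2 * x"] assms s_mono[of 0 j] s_mono[OF j]
      by (simp add: s0 sn)
    also have "\<dots> \<le> ?K"
      using K s_mono[of 0 j] s_mono[OF j] assms
      by (intro mult_mono mult_nonneg_nonneg) (auto simp: s0 sn intro!: powr_mono2')
    finally show "prob {\<omega> \<in> space M. 2 * x \<le> \<bar>\<Sum>i\<in>{j..<n}. \<xi> i \<omega>\<bar>} \<le> ?K"
      using j by (simp add: part)
  qed
  \<comment> \<open>The sums of increments telescope to the process minus \<open>X 0\<close>, which
    vanishes only almost surely.\<close>
  also have "prob {\<omega> \<in> space M. \<exists>j\<le>n. 3 * x < \<bar>\<Sum>i<j. \<xi> i \<omega>\<bar>}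
      = prob {\<omega> \<in> space M. \<exists>j\<le>n. 3 * x < \<bar>X (s j) \<omega>\<bar>}"
  proof (rule measure_eq_AE)
    have "AE \<omega> in M. X 0 \<omega> = 0" using X by (simp add: sym_stable_process_def)
    then show "AE \<omega> in M. (\<omega> \<in> {\<omega> \<in> space M. \<exists>j\<le>n. 3 * x < \<bar>\<Sum>i<j. \<xi> i \<omega>\<bar>})
        = (\<omega> \<in> {\<omega> \<in> space M. \<exists>j\<le>n. 3 * x < \<bar>X (s j) \<omega>\<bar>})"
      by eventually_elim (simp add: init)
  qed (unfold \<xi>_def, measurable)
  finally show ?thesis by (simp add: s_def mult_ac)
qed

section \<open>Dyadic grids and suprema over a time interval\<close>

text \<open>Each level refines the previous one, so events about the levels increase. The right
  endpoint belongs to the grid on purpose: right-continuity cannot recover the value at T from other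
  times in [0, T].\<close>

definition dyadic_grid :: "real \<Rightarrow> real set" where
  "dyadic_grid T = (\<Union>n. (\<lambda>j. T * real j / 2 ^ n) ` {..2 ^ n :: nat})"

lemma countable_dyadic_grid: "countable (dyadic_grid T)"
  unfolding dyadic_grid_def by auto

lemma dyadic_grid_subset: "0 \<le> T \<Longrightarrow> dyadic_grid T \<subseteq> {0..T}"
proof -
  assume T: "0 \<le> T"
  have "T * real j / 2 ^ n \<le> T" if "j \<le> 2 ^ n" for j n :: nat
  proof -
    have "real j \<le> 2 ^ n" using that by (metis of_nat_le_iff of_nat_numeral of_nat_power)
    then have "T * real j \<le> T * 2 ^ n" using T by (rule mult_left_mono)
    then show ?thesis by (simp add: pos_divide_le_eq)
  qed
  then show ?thesis using T by (auto simp: dyadic_grid_def)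
qed

lemma endpoint_mem_dyadic_grid: "T \<in> dyadic_grid T"
  unfolding dyadic_grid_def by (intro UN_I[of 0] image_eqI[of _ _ 1]) auto

lemma dyadic_grid_dense:
  assumes "0 \<le> s" "s < t" "t \<le> T"
  obtains d where "d \<in> dyadic_grid T" "s < d" "d < t"
proof -
  have T: "0 < T" using assms by simp
  obtain n where n: "T / (t - s) < 2 ^ n" using real_arch_pow[of 2 "T / (t - s)"] by auto
  define j where "j = nat (\<lfloor>s * 2 ^ n / T\<rfloor> + 1)"
  have "0 \<le> s * 2 ^ n / T" using assms T by simp
  then have "0 \<le> \<lfloor>s * 2 ^ n / T\<rfloor>" by simp
  then have "real j = of_int \<lfloor>s * 2 ^ n / T\<rfloor> + 1"
    by (simp add: j_def)
  then have "s * 2 ^ n / T < real j" "real j \<le> s * 2 ^ n / T + 1" by linarith+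
  then have sd: "s < T * real j / 2 ^ n" and dle: "T * real j / 2 ^ n \<le> s + T / 2 ^ n"
    using T by (simp_all add: field_simps)
  have "T / 2 ^ n < t - s" using n assms by (simp add: field_simps)
  then have dt: "T * real j / 2 ^ n < t" using dle by simp
  then have "T * real j / 2 ^ n < T" using assms by simp
  then have "real j < 2 ^ n" using T by (simp add: field_simps)
  then have "j \<le> 2 ^ n" by (metis less_imp_le of_nat_less_iff of_nat_numeral of_nat_power)
  then show thesis using that[OF _ sd dt] unfolding dyadic_grid_def by auto
qed

text \<open>A value above \<open>c\<close> at t < T persists on an interval to the right of t, which
  meets the grid; t = T is itself a grid point. The codomain is general because both real paths and
  \<open>ennreal\<close> sums are treated.\<close>

lemma le_of_dyadic_grid_le:
  fixes f :: "real \<Rightarrow> 'b::linorder_topology"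
  assumes f: "\<And>t. 0 \<le> t \<Longrightarrow> (f \<longlongrightarrow> f t) (at_right t)"
    and le: "\<And>d. d \<in> dyadic_grid T \<Longrightarrow> f d \<le> c" and t: "0 \<le> t" "t \<le> T"
  shows "f t \<le> c"
proof (rule ccontr)
  assume "\<not> f t \<le> c"
  then have "c < f t" by simp
  then have "t \<noteq> T" using le[OF endpoint_mem_dyadic_grid] by auto
  have "\<forall>\<^sub>F s in at_right t. c < f s"
    using f[OF t(1)] \<open>c < f t\<close> by (rule order_tendstoD)
  then obtain u where u: "t < u" "\<And>s. t < s \<Longrightarrow> s < u \<Longrightarrow> c < f s"
    unfolding eventually_at_right_field by auto
  have "t < min u T" using u(1) \<open>t \<noteq> T\<close> t by simp
  then obtain d where "d \<in> dyadic_grid T" "t < d" "d < min u T"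
    using dyadic_grid_dense[OF t(1), of "min u T" T] by (metis min.cobounded2)
  then show False using u(2)[of d] le[of d] by auto
qed

text \<open>The bound of \<open>stable_grid_tail\<close> is uniform in the number of points and
  passes to the increasing union of the levels by continuity of the measure. Its factor 3 is moved
  into the level as \<open>x / 3\<close>.\<close>

lemma (in prob_space) stable_sup_tail:
  assumes X: "sym_stable_process \<alpha> X" and "0 < \<alpha>" "0 \<le> T" "0 < x"
  shows "prob {\<omega> \<in> space M. \<exists>d\<in>dyadic_grid T. x < \<bar>X d \<omega>\<bar>}
    \<le> 2 * stable_tail_const \<alpha> * T * (x / 3) powr - \<alpha>"
proof -
  have meas [measurable]: "X (T * real j / 2 ^ n) \<in> borel_measurable M" for j n :: nat
    using X \<open>0 \<le> T\<close> by (simp add: sym_stable_process_def)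
  define G where "G = (\<lambda>n. {\<omega> \<in> space M. \<exists>j\<le>(2::nat) ^ n. x < \<bar>X (T * real j / 2 ^ n) \<omega>\<bar>})"
  have G_sets: "G n \<in> events" for n unfolding G_def by measurable
  have union: "{\<omega> \<in> space M. \<exists>d\<in>dyadic_grid T. x < \<bar>X d \<omega>\<bar>} = (\<Union>n. G n)"
    by (auto simp: G_def dyadic_grid_def)
  have "incseq G"
  proof (rule incseq_SucI, rule subsetI)
    fix n \<omega> assume "\<omega> \<in> G n"
    then obtain j where j: "\<omega> \<in> space M" "j \<le> 2 ^ n" "x < \<bar>X (T * real j / 2 ^ n) \<omega>\<bar>"
      by (auto simp: G_def)
    have "T * real (2 * j) / 2 ^ Suc n = T * real j / 2 ^ n" by simp
    then show "\<omega> \<in> G (Suc n)" unfolding G_def using j by (intro CollectI conjI exI[of _ "2 * j"]) auto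
  qed
  then have "(\<lambda>n. prob (G n)) \<longlonglongrightarrow> prob (\<Union>n. G n)"
    using G_sets by (intro finite_Lim_measure_incseq) auto
  moreover have "prob (G n) \<le> 2 * stable_tail_const \<alpha> * T * (x / 3) powr - \<alpha>" for n
    unfolding G_def using stable_grid_tail[OF X \<open>0 < \<alpha>\<close> \<open>0 \<le> T\<close>, of "x / 3" "2 ^ n"] \<open>0 < x\<close> by simp
  ultimately show ?thesis unfolding union by (intro LIMSEQ_le_const2) auto
qed

section \<open>Tails and moments of sums\<close>

lemma le_suminf_ennreal: "f n \<le> suminf (f :: nat \<Rightarrow> ennreal)"
  using sum_le_suminf[of f "{n}"] by simp

text \<open>A discrete layer-cake formula: a nonzero truncated value lies in exactly one layer from
  y/2^(n+1) (excluded) to y/2^n (included), and the upper edge of that layer is one of the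
  summands.\<close>

lemma min_le_dyadic_layers:
  fixes u :: ennreal
  assumes "0 < y"
  shows "min u (ennreal y) \<le> (\<Sum>n. ennreal (y / 2 ^ n) * indicator {v. ennreal (y / 2 ^ Suc n) < v} u)"
proof (cases "u = 0")
  case False
  have "min u (ennreal y) \<noteq> \<top>" by (metis ennreal_neq_top min.cobounded2 top_unique)
  then obtain w where w: "min u (ennreal y) = ennreal w" "0 \<le> w"
    by (cases "min u (ennreal y)") auto
  have "0 < w" using w False assms by (metis ennreal_eq_0_iff ennreal_less_zero_iff less_le min_def zero_le)
  have "w \<le> y" using w assms by (metis ennreal_le_iff less_imp_le min.cobounded2)
  then obtain n where n: "2 ^ n \<le> y / w" "y / w < 2 ^ Suc n"
    using dyadic_bracket[of "y / w"] \<open>0 < w\<close> by auto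
  have "w \<le> y / 2 ^ n" "y / 2 ^ Suc n < w"
    using n \<open>0 < w\<close> by (simp_all add: field_simps)
  then have "ennreal (y / 2 ^ Suc n) < min u (ennreal y)"
    using w assms by (simp add: ennreal_less_iff)
  then have *: "ennreal (y / 2 ^ Suc n) < u" by simp
  have "min u (ennreal y) \<le> ennreal (y / 2 ^ n)"
    using w \<open>w \<le> y / 2 ^ n\<close> by (simp add: ennreal_leI)
  also have "\<dots> = ennreal (y / 2 ^ n) * indicator {v. ennreal (y / 2 ^ Suc n) < v} u"
    using * by simp
  also have "\<dots> \<le> (\<Sum>n. ennreal (y / 2 ^ n) * indicator {v. ennreal (y / 2 ^ Suc n) < v} u)"
    by (rule le_suminf_ennreal)
  finally show ?thesis .
qed simp

text \<open>Layer n contributes a multiple of (y/2^n)^(1 - r), a geometric series that converges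
  because r < 1. The factor \<open>2 powr r\<close> appears because the tail is evaluated at the
  lower edge, half of the upper one.\<close>

lemma nn_integral_min_le_tail:
  fixes Y :: "'a \<Rightarrow> ennreal"
  assumes [measurable]: "Y \<in> borel_measurable M"
    and tail: "\<And>y. 0 < y \<Longrightarrow> emeasure M {\<omega> \<in> space M. ennreal y < Y \<omega>} \<le> ennreal (A * y powr - r)"
    and "0 < r" "r < 1" "0 \<le> A" "0 < y"
  shows "(\<integral>\<^sup>+\<omega>. min (Y \<omega>) (ennreal y) \<partial>M) \<le> ennreal (A * 2 powr r * y powr (1 - r) / (1 - 2 powr (r - 1)))"
proof -
  have "(\<integral>\<^sup>+\<omega>. min (Y \<omega>) (ennreal y) \<partial>M)
      \<le> (\<integral>\<^sup>+\<omega>. (\<Sum>n. ennreal (y / 2 ^ n) * indicator {v. ennreal (y / 2 ^ Suc n) < v} (Y \<omega>)) \<partial>M)"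
    by (intro nn_integral_mono min_le_dyadic_layers \<open>0 < y\<close>)
  also have "\<dots> = (\<Sum>n. \<integral>\<^sup>+\<omega>. ennreal (y / 2 ^ n) * indicator {v. ennreal (y / 2 ^ Suc n) < v} (Y \<omega>) \<partial>M)"
    by (intro nn_integral_suminf) measurable
  also have "\<dots> = (\<Sum>n. ennreal (y / 2 ^ n) * emeasure M {\<omega> \<in> space M. ennreal (y / 2 ^ Suc n) < Y \<omega>})"
  proof -
    have "(\<integral>\<^sup>+\<omega>. ennreal (y / 2 ^ n) * indicator {v. ennreal (y / 2 ^ Suc n) < v} (Y \<omega>) \<partial>M)
      = (\<integral>\<^sup>+\<omega>. ennreal (y / 2 ^ n) * indicator {\<omega> \<in> space M. ennreal (y / 2 ^ Suc n) < Y \<omega>} \<omega> \<partial>M)" for n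
      by (intro nn_integral_cong) (simp add: indicator_def)
    then show ?thesis by (simp add: nn_integral_cmult_indicator)
  qed
  also have "\<dots> \<le> (\<Sum>n. ennreal (A * 2 powr r * (y / 2 ^ n) powr (1 - r)))"
  proof (rule suminf_le)
    fix n
    have "ennreal (y / 2 ^ n) * emeasure M {\<omega> \<in> space M. ennreal (y / 2 ^ Suc n) < Y \<omega>}
      \<le> ennreal (y / 2 ^ n) * ennreal (A * (y / 2 ^ Suc n) powr - r)"
      using \<open>0 < y\<close> by (intro mult_left_mono tail) auto
    also have "\<dots> = ennreal ((y / 2 ^ n) * (A * (y / 2 ^ Suc n) powr - r))"
      using assms(5,6) by (intro ennreal_mult[symmetric]) auto
    also have "(y / 2 ^ n) * (A * (y / 2 ^ Suc n) powr - r) = A * 2 powr r * (y / 2 ^ n) powr (1 - r)"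
    proof -
      define v where "v = y / 2 ^ n"
      have "0 < v" "y / 2 ^ Suc n = v / 2" using \<open>0 < y\<close> by (simp_all add: v_def)
      then show ?thesis unfolding v_def[symmetric]
        by (simp add: powr_divide powr_diff powr_minus field_simps)
    qed
    finally show "ennreal (y / 2 ^ n) * emeasure M {\<omega> \<in> space M. ennreal (y / 2 ^ Suc n) < Y \<omega>}
      \<le> ennreal (A * 2 powr r * (y / 2 ^ n) powr (1 - r))" .
  qed auto
  also have "\<dots> = ennreal (A * 2 powr r * y powr (1 - r) / (1 - 2 powr (r - 1)))"
    using dyadic_powr_sums[of "1 - r" y "A * 2 powr r"] assms by (intro suminf_ennreal_eq) auto
  finally show ?thesis .
qed

text \<open>The summand 1 pays for the event that a single term exceeds the level, the fraction for
  the truncated sum in Markov's inequality.\<close>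

definition sum_tail_const :: "real \<Rightarrow> real" where
  "sum_tail_const r = 1 + 2 powr r / (1 - 2 powr (r - 1))"

lemma sum_tail_const_nonneg: "r < 1 \<Longrightarrow> 0 \<le> sum_tail_const r"
  using powr_less_mono[of "r - 1" 0 2] by (simp add: sum_tail_const_def)

text \<open>Since \<open>r < 1\<close>, the truncated variables \<open>min (Y i) y\<close> have means of order \<open>y powr (1 - r)\<close>,
  which Markov's inequality turns into the same tail.\<close>

lemma suminf_tail:
  fixes Y :: "nat \<Rightarrow> 'a \<Rightarrow> ennreal"
  assumes [measurable]: "\<And>i. Y i \<in> borel_measurable M"
    and tail: "\<And>i y. 0 < y \<Longrightarrow> emeasure M {\<omega> \<in> space M. ennreal y < Y i \<omega>} \<le> ennreal (A i * y powr - r)"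
    and r: "0 < r" "r < 1" and A: "\<And>i. 0 \<le> A i" "summable A" and y: "0 < y"
  shows "emeasure M {\<omega> \<in> space M. ennreal y < (\<Sum>i. Y i \<omega>)} \<le> ennreal (sum_tail_const r * suminf A * y powr - r)"
proof -
  have r2: "0 < 1 - 2 powr (r - 1)" using powr_less_mono[of "r - 1" 0 2] r by simp
  have A0: "0 \<le> suminf A" using A by (intro suminf_nonneg)
  let ?L = "\<Union>i. {\<omega> \<in> space M. ennreal y < Y i \<omega>}"
  let ?m = "\<lambda>\<omega>. \<Sum>i. min (Y i \<omega>) (ennreal y)"
  let ?S = "{\<omega> \<in> space M. 1 \<le> ennreal (1 / y) * ?m \<omega>}"
  have sub: "{\<omega> \<in> space M. ennreal y < (\<Sum>i. Y i \<omega>)} \<subseteq> ?L \<union> ?S"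
  proof
    fix \<omega> assume \<omega>: "\<omega> \<in> {\<omega> \<in> space M. ennreal y < (\<Sum>i. Y i \<omega>)}"
    show "\<omega> \<in> ?L \<union> ?S"
    proof (cases "\<omega> \<in> ?L")
      case False
      \<comment> \<open>Where no single term exceeds \<open>y\<close>, truncation changes nothing,
        so the truncated sum is already large.\<close>
      then have "min (Y i \<omega>) (ennreal y) = Y i \<omega>" for i using \<omega> by (auto simp: min_def not_less)
      then have "ennreal y \<le> ?m \<omega>" using \<omega> by (simp add: less_imp_le)
      then have "ennreal (1 / y) * ennreal y \<le> ennreal (1 / y) * ?m \<omega>" by (intro mult_left_mono) auto
      also have "ennreal (1 / y) * ennreal y = 1" using y by (simp flip: ennreal_mult)
      finally show ?thesis using \<omega> by simp
    qed simp
  qed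
  have sets: "?L \<in> sets M" "?S \<in> sets M" by measurable
  have "emeasure M {\<omega> \<in> space M. ennreal y < (\<Sum>i. Y i \<omega>)} \<le> emeasure M (?L \<union> ?S)"
    using sub sets by (intro emeasure_mono sets.Un)
  also have "\<dots> \<le> emeasure M ?L + emeasure M ?S"
    using sets by (rule emeasure_subadditive)
  also have "emeasure M ?L \<le> ennreal (suminf A * y powr - r)"
  proof -
    have "emeasure M ?L \<le> (\<Sum>i. emeasure M {\<omega> \<in> space M. ennreal y < Y i \<omega>})"
      by (intro emeasure_subadditive_countably) auto
    also have "\<dots> \<le> (\<Sum>i. ennreal (A i * y powr - r))"
      using y by (intro suminf_le tail) auto
    also have "\<dots> = ennreal (suminf A * y powr - r)"
      using A by (intro suminf_ennreal_eq sums_mult2 summable_sums) auto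
    finally show ?thesis .
  qed
  also have "emeasure M ?S \<le> ennreal (2 powr r / (1 - 2 powr (r - 1)) * suminf A * y powr - r)"
  proof -
    have "emeasure M ?S \<le> ennreal (1 / y) * (\<integral>\<^sup>+\<omega>. ?m \<omega> * indicator (space M) \<omega> \<partial>M)"
      by (rule nn_integral_Markov_inequality) auto
    also have "(\<integral>\<^sup>+\<omega>. ?m \<omega> * indicator (space M) \<omega> \<partial>M) = (\<Sum>i. \<integral>\<^sup>+\<omega>. min (Y i \<omega>) (ennreal y) \<partial>M)"
      by (subst nn_integral_suminf[symmetric]) (auto intro!: nn_integral_cong)
    also have "\<dots> \<le> (\<Sum>i. ennreal (A i * 2 powr r * y powr (1 - r) / (1 - 2 powr (r - 1))))"
      using r A y by (intro suminf_le nn_integral_min_le_tail tail) auto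
    also have "\<dots> = ennreal (suminf A * (2 powr r * y powr (1 - r) / (1 - 2 powr (r - 1))))"
    proof (rule suminf_ennreal_eq)
      show "(\<lambda>i. A i * 2 powr r * y powr (1 - r) / (1 - 2 powr (r - 1))) sums
          (suminf A * (2 powr r * y powr (1 - r) / (1 - 2 powr (r - 1))))"
        using sums_mult2[OF summable_sums[OF A(2)], of "2 powr r * y powr (1 - r) / (1 - 2 powr (r - 1))"]
        by (simp add: mult_ac)
    qed (use A r2 in auto)
    also have "ennreal (1 / y) * \<dots> = ennreal (1 / y * (suminf A * (2 powr r * y powr (1 - r) / (1 - 2 powr (r - 1)))))"
      using A0 r2 y by (intro ennreal_mult[symmetric]) auto
    also have "1 / y * (suminf A * (2 powr r * y powr (1 - r) / (1 - 2 powr (r - 1))))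
        = 2 powr r / (1 - 2 powr (r - 1)) * suminf A * y powr - r"
      using y by (simp add: powr_diff powr_minus field_simps)
    finally show ?thesis by (simp add: mult_left_mono)
  qed
  finally have "emeasure M {\<omega> \<in> space M. ennreal y < (\<Sum>i. Y i \<omega>)}
      \<le> ennreal (suminf A * y powr - r) + ennreal (2 powr r / (1 - 2 powr (r - 1)) * suminf A * y powr - r)"
    by (simp add: add_mono)
  also have "\<dots> = ennreal (sum_tail_const r * suminf A * y powr - r)"
    using A0 r2 by (subst ennreal_plus[symmetric]) (auto simp: sum_tail_const_def algebra_simps)
  finally show ?thesis .
qed

section \<open>Powers and moments of extended nonnegative variables\<close>

lemma epowr_epowr: "epowr (epowr u a) b = epowr u (a * b)"
  by (simp add: epowr_def powr_powr)

lemma epowr_one: "epowr u 1 = u"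
  by (cases u) (auto simp: epowr_def)

lemma epowr_mono: "0 \<le> a \<Longrightarrow> u \<le> v \<Longrightarrow> epowr u a \<le> epowr v a"
  by (cases u; cases v) (auto simp: epowr_def top_unique intro!: ennreal_leI powr_mono2)

text \<open>For a > 0 the power is an order isomorphism whose inverse is the power 1/a, so it
  commutes with all suprema.\<close>

lemma epowr_SUP:
  assumes "0 < a"
  shows "(SUP i\<in>I. epowr (f i) a) = epowr (SUP i\<in>I. f i) a"
proof (rule antisym)
  let ?S = "SUP i\<in>I. epowr (f i) a"
  show "?S \<le> epowr (SUP i\<in>I. f i) a"
    using assms by (intro SUP_least epowr_mono SUP_upper) auto
  have "f i \<le> epowr ?S (1 / a)" if "i \<in> I" for i
  proof -
    have "epowr (epowr (f i) a) (1 / a) \<le> epowr ?S (1 / a)"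
      using assms that by (intro epowr_mono SUP_upper) auto
    then show ?thesis using assms by (simp add: epowr_epowr epowr_one)
  qed
  then have "epowr (SUP i\<in>I. f i) a \<le> epowr (epowr ?S (1 / a)) a"
    using assms by (intro epowr_mono SUP_least) auto
  then show "epowr (SUP i\<in>I. f i) a \<le> ?S" using assms by (simp add: epowr_epowr epowr_one)
qed

lemma borel_measurable_epowr [measurable]: "(\<lambda>u. epowr u a) \<in> borel_measurable borel"
  unfolding epowr_def by measurable

text \<open>The first term covers values up to x; a larger finite value between x 2^n and x 2^(n+1)
  is covered by layer n. The threshold is half the lower edge so that the strict inequality also
  holds at the edge itself. For infinite \<open>u\<close> all layers are active, and each
  contributes at least \<open>x powr q\<close>.\<close>

lemma epowr_le_dyadic_layers:
  assumes "0 < x" "0 < q"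
  shows "epowr u q \<le> ennreal (x powr q)
    + (\<Sum>n. ennreal ((x * 2 ^ Suc n) powr q) * indicator {v. ennreal (x * 2 ^ n / 2) < v} u)"
    (is "_ \<le> _ + suminf ?g")
proof (cases "u = \<infinity>")
  case True
  have "of_nat n * ennreal (x powr q) \<le> suminf ?g" for n
  proof -
    have "of_nat n * ennreal (x powr q) = (\<Sum>i<n. ennreal (x powr q))" by simp
    also have "\<dots> \<le> (\<Sum>i<n. ?g i)"
    proof (rule sum_mono)
      fix i :: nat
      have "x * 1 \<le> x * 2 ^ Suc i" using assms by (intro mult_left_mono one_le_power) auto
      then have "x powr q \<le> (x * 2 ^ Suc i) powr q" using assms by (intro powr_mono2) auto
      then show "ennreal (x powr q) \<le> ?g i" using True by (simp add: ennreal_leI less_top[symmetric])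
    qed
    also have "\<dots> \<le> suminf ?g" by (intro sum_le_suminf) auto
    finally show ?thesis .
  qed
  then have "(SUP n. of_nat n * ennreal (x powr q)) \<le> suminf ?g" by (intro SUP_least)
  then have "suminf ?g = \<infinity>"
    using assms by (simp add: SUP_mult_right_ennreal[symmetric] ennreal_SUP_of_nat_eq_top ennreal_top_mult top_unique)
  then show ?thesis by simp
next
  case False
  then obtain v where v: "u = ennreal v" "0 \<le> v" by (cases u) auto
  show ?thesis
  proof (cases "v \<le> x")
    case True
    then have "epowr u q \<le> ennreal (x powr q)"
      using v assms by (auto simp: epowr_def intro!: ennreal_leI powr_mono2)
    then show ?thesis by (rule order_trans) simp
  next
    case False
    then obtain n where n: "2 ^ n \<le> v / x" "v / x < 2 ^ Suc n"
      using dyadic_bracket[of "v / x"] assms by auto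
    have "x * 2 ^ n \<le> v" "v < x * 2 ^ Suc n" using n assms by (simp_all add: field_simps)
    moreover have "x * 2 ^ n / 2 < x * 2 ^ n" using assms by simp
    ultimately have "x * 2 ^ n / 2 < v" "v \<le> x * 2 ^ Suc n" by linarith+
    then have "epowr u q \<le> ?g n"
      using v assms by (auto simp: epowr_def ennreal_less_iff intro!: ennreal_leI powr_mono2)
    also have "\<dots> \<le> suminf ?g" by (rule le_suminf_ennreal)
    finally show ?thesis by (rule order_trans) simp
  qed
qed

text \<open>In the exponent q + r, the q comes from bounding a layer by its upper edge and the r
  from the halved threshold; the ratio 2^(q - r) between successive layers is below 1 when q <
  r.\<close>

definition moment_const :: "real \<Rightarrow> real \<Rightarrow> real" where
  "moment_const q r = 1 + 2 powr (q + r) / (1 - 2 powr (q - r))"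

text \<open>The splitting level is B^(1/r), where the bound B x^(-r) equals 1. It produces the
  homogeneous factor B^(q/r), the origin of the power T^(p/\<alpha>).\<close>

lemma (in prob_space) moment_le_tail:
  fixes U :: "'a \<Rightarrow> ennreal"
  assumes [measurable]: "U \<in> borel_measurable M"
    and tail: "\<And>y. 0 < y \<Longrightarrow> emeasure M {\<omega> \<in> space M. ennreal y < U \<omega>} \<le> ennreal (B * y powr - r)"
    and "0 < q" "q < r" "0 < B"
  shows "(\<integral>\<^sup>+\<omega>. epowr (U \<omega>) q \<partial>M) \<le> ennreal (B powr (q / r) * moment_const q r)"
proof -
  define x where "x = B powr (1 / r)"
  have x: "0 < x" and xq: "x powr q = B powr (q / r)" and xr: "B * x powr - r = 1"
    using assms by (simp_all add: x_def powr_powr powr_minus)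
  let ?g = "\<lambda>n \<omega>. ennreal ((x * 2 ^ Suc n) powr q) * indicator {v. ennreal (x * 2 ^ n / 2) < v} (U \<omega>)"
  have "(\<integral>\<^sup>+\<omega>. epowr (U \<omega>) q \<partial>M) \<le> (\<integral>\<^sup>+\<omega>. ennreal (x powr q) + (\<Sum>n. ?g n \<omega>) \<partial>M)"
    by (intro nn_integral_mono epowr_le_dyadic_layers x \<open>0 < q\<close>)
  also have "\<dots> = ennreal (x powr q) + (\<Sum>n. \<integral>\<^sup>+\<omega>. ?g n \<omega> \<partial>M)"
    by (subst nn_integral_add) (auto simp: nn_integral_suminf emeasure_space_1)
  also have "(\<Sum>n. \<integral>\<^sup>+\<omega>. ?g n \<omega> \<partial>M) \<le> (\<Sum>n. ennreal (x powr q * 2 powr (q + r) * (1 / 2 ^ n) powr (r - q)))"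
  proof (rule suminf_le)
    fix n
    have "(\<integral>\<^sup>+\<omega>. ?g n \<omega> \<partial>M)
      = (\<integral>\<^sup>+\<omega>. ennreal ((x * 2 ^ Suc n) powr q) * indicator {\<omega> \<in> space M. ennreal (x * 2 ^ n / 2) < U \<omega>} \<omega> \<partial>M)"
      by (intro nn_integral_cong) (simp add: indicator_def)
    also have "\<dots> = ennreal ((x * 2 ^ Suc n) powr q) * emeasure M {\<omega> \<in> space M. ennreal (x * 2 ^ n / 2) < U \<omega>}"
      by (simp add: nn_integral_cmult_indicator)
    also have "\<dots> \<le> ennreal ((x * 2 ^ Suc n) powr q) * ennreal (B * (x * 2 ^ n / 2) powr - r)"
      using x by (intro mult_left_mono tail) auto
    also have "\<dots> = ennreal ((x * 2 ^ Suc n) powr q * (B * (x * 2 ^ n / 2) powr - r))"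
      using \<open>0 < B\<close> by (simp add: ennreal_mult)
    also have "(x * 2 ^ Suc n) powr q * (B * (x * 2 ^ n / 2) powr - r)
        = (B * x powr - r) * (x powr q * 2 powr (q + r) * (1 / 2 ^ n) powr (r - q))"
    proof -
      define w :: real where "w = 2 ^ n"
      have "0 < w" by (simp add: w_def)
      then show ?thesis
        unfolding power_Suc w_def[symmetric] using x
        by (simp add: powr_mult powr_divide powr_diff powr_add powr_minus field_simps)
    qed
    finally show "(\<integral>\<^sup>+\<omega>. ?g n \<omega> \<partial>M) \<le> ennreal (x powr q * 2 powr (q + r) * (1 / 2 ^ n) powr (r - q))"
      by (simp add: xr)
  qed auto
  also have "\<dots> = ennreal (x powr q * 2 powr (q + r) / (1 - 2 powr (q - r)))"
    using dyadic_powr_sums[of "r - q" 1 "x powr q * 2 powr (q + r)"] assms by (intro suminf_ennreal_eq) auto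
  also have "ennreal (x powr q) + \<dots> = ennreal (B powr (q / r) * moment_const q r)"
    using powr_less_mono[of "q - r" 0 2] \<open>q < r\<close>
    by (subst ennreal_plus[symmetric]) (auto simp: moment_const_def xq[symmetric] algebra_simps)
  finally show ?thesis by (simp add: add_left_mono)
qed

section \<open>The stochastic convolution\<close>

text \<open>Moving the differences onto \<open>g\<close> leaves the boundary term
  \<open>g n * x (Suc n)\<close> and the values of \<open>x\<close> weighted by \<open>g 0\<close>
  and by the increments of \<open>g\<close>. These weights are nonnegative with total
  \<open>g n\<close>, so each of the two parts is at most \<open>g n * B\<close>.\<close>

lemma abs_sum_mult_increments_le:
  fixes g x :: "nat \<Rightarrow> real"
  assumes "0 \<le> g 0" "\<And>i. i < n \<Longrightarrow> g i \<le> g (Suc i)" "\<And>i. i \<le> Suc n \<Longrightarrow> \<bar>x i\<bar> \<le> B"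
  shows "\<bar>\<Sum>i<Suc n. g i * (x (Suc i) - x i)\<bar> \<le> 2 * g n * B"
proof -
  have g0: "0 \<le> g m" if "m \<le> n" for m
    using that assms(1,2) by (induction m) (auto simp: Suc_le_eq intro: order_trans)
  have "\<bar>(\<Sum>i<Suc m. g i * (x (Suc i) - x i)) - g m * x (Suc m)\<bar> \<le> g m * B" if "m \<le> n" for m
    using that
  proof (induction m)
    case 0
    show ?case
      using mult_left_mono[OF assms(3)[of 0] assms(1)] assms(1) by (simp add: algebra_simps abs_mult)
  next
    case (Suc m)
    have "(\<Sum>i<Suc (Suc m). g i * (x (Suc i) - x i)) - g (Suc m) * x (Suc (Suc m))
        = ((\<Sum>i<Suc m. g i * (x (Suc i) - x i)) - g m * x (Suc m)) - (g (Suc m) - g m) * x (Suc m)"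
      by (simp add: algebra_simps)
    also have "\<bar>\<dots>\<bar> \<le> g m * B + (g (Suc m) - g m) * B"
    proof (rule order_trans[OF abs_triangle_ineq4 add_mono])
      show "\<bar>(g (Suc m) - g m) * x (Suc m)\<bar> \<le> (g (Suc m) - g m) * B"
        using Suc.prems assms(2)[of m] assms(3)[of "Suc m"] by (simp add: abs_mult mult_left_mono)
    qed (use Suc in simp)
    finally show ?case by (simp add: algebra_simps)
  qed
  from this[OF order_refl] have "\<bar>\<Sum>i<Suc n. g i * (x (Suc i) - x i)\<bar> \<le> g n * B + \<bar>g n * x (Suc n)\<bar>"
    by linarith
  also have "\<bar>g n * x (Suc n)\<bar> \<le> g n * B"
    using g0[of n] assms(3)[of "Suc n"] by (simp add: abs_mult mult_left_mono)
  finally show ?thesis by (simp add: mult_ac)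
qed

text \<open>The bound passes from Riemann sums to \<open>I\<close> along a sequence of partitions that converges
  almost surely by Borel--Cantelli.\<close>

lemma (in prob_space) stoch_integral_bound:
  assumes int: "has_stoch_integral X (\<lambda>s. g s * c) t I" and t: "0 \<le> t"
    and X: "\<And>s. 0 \<le> s \<Longrightarrow> X s \<in> borel_measurable M"
    and g: "0 \<le> g 0" "mono_on {0..t} g"
  shows "AE \<omega> in M. \<forall>B. (\<forall>s\<in>{0..t}. \<bar>X s \<omega>\<bar> \<le> B) \<longrightarrow> \<bar>I \<omega>\<bar> \<le> 2 * g t * \<bar>c\<bar> * B"
proof -
  have [measurable]: "I \<in> borel_measurable M" using int by (simp add: has_stoch_integral_def)
  \<comment> \<open>\<open>Suc n\<close> intervals guarantee at least one, as the division and the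
    form of \<open>abs_sum_mult_increments_le\<close> require.\<close>
  define s where "s = (\<lambda>n i. t * real i / real (Suc n))"
  define R where "R = (\<lambda>n \<omega>. \<Sum>i<Suc n. g (s n i) * c * (X (s n (Suc i)) \<omega> - X (s n i) \<omega>))"
  have s_nonneg: "0 \<le> s n i" for n i using t by (simp add: s_def)
  have s_mono: "s n i \<le> s n j" if "i \<le> j" for n i j
    unfolding s_def using that t by (intro divide_right_mono mult_left_mono) auto
  have s_end: "s n 0 = 0" "s n (Suc n) = t" for n by (simp_all add: s_def)
  have s_le: "s n i \<le> t" if "i \<le> Suc n" for n i using s_mono[OF that, of n] s_end by simp
  have [measurable]: "R n \<in> borel_measurable M" for n
    unfolding R_def by (intro borel_measurable_sum borel_measurable_times borel_measurable_diff
      borel_measurable_const X s_nonneg)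
  \<comment> \<open>The definition of the integral uses one \<epsilon> for the deviation and for its
    probability; with \<epsilon> = (1/2)^k the deviations vanish and the probabilities are
    summable.\<close>
  have "\<exists>n. prob {\<omega> \<in> space M. (1/2)^k < \<bar>R n \<omega> - I \<omega>\<bar>} < (1/2)^k" for k :: nat
  proof -
    obtain \<delta> where "0 < \<delta>" and \<delta>: "\<And>n s. s 0 = 0 \<and> s n = t \<and> (\<forall>i<n. s i \<le> s (Suc i) \<and> s (Suc i) - s i < \<delta>) \<Longrightarrow>
        prob {\<omega> \<in> space M. \<bar>(\<Sum>i<n. g (s i) * c * (X (s (Suc i)) \<omega> - X (s i) \<omega>)) - I \<omega>\<bar> > (1/2)^k} < (1/2)^k"
    proof -
      have "0 < (1/2::real)^k" by simp
      then show ?thesis using int that unfolding has_stoch_integral_def by blast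
    qed
    obtain n where n: "t / \<delta> < real n" using reals_Archimedean2 by blast
    then have "t < real n * \<delta>" using \<open>0 < \<delta>\<close> by (simp add: pos_divide_less_eq)
    also have "\<dots> \<le> real (Suc n) * \<delta>" using \<open>0 < \<delta>\<close> by simp
    finally have "t / real (Suc n) < \<delta>" by (simp add: pos_divide_less_eq mult.commute del: of_nat_Suc)
    moreover have "s n (Suc i) - s n i = t / real (Suc n)" for i
      by (simp add: s_def flip: diff_divide_distrib right_diff_distrib)
    ultimately have "prob {\<omega> \<in> space M. \<bar>(\<Sum>i<Suc n. g (s n i) * c * (X (s n (Suc i)) \<omega> - X (s n i) \<omega>)) - I \<omega>\<bar> > (1/2)^k} < (1/2)^k"
      using s_end s_mono by (intro \<delta>) auto
    then show ?thesis unfolding R_def by blast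
  qed
  then obtain n where n: "\<And>k. prob {\<omega> \<in> space M. (1/2)^k < \<bar>R (n k) \<omega> - I \<omega>\<bar>} < (1/2)^k"
    by metis
  let ?A = "\<lambda>k. {\<omega> \<in> space M. (1/2)^k < \<bar>R (n k) \<omega> - I \<omega>\<bar>}"
  have "AE \<omega> in M. \<forall>\<^sub>F k in sequentially. \<omega> \<in> space M - ?A k"
  proof (rule borel_cantelli_AE1)
    show "summable (\<lambda>k. prob (?A k))"
    proof (rule summable_comparison_test')
      show "summable (\<lambda>k. (1/2::real)^k)" by (rule summable_geometric) simp
      show "norm (prob (?A k)) \<le> (1/2)^k" for k using n[of k] by simp
    qed
  qed (auto simp: emeasure_eq_measure)
  then show ?thesis
  proof eventually_elim
    case (elim \<omega>)
    show ?case
    proof (intro allI impI)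
      fix B assume B: "\<forall>s\<in>{0..t}. \<bar>X s \<omega>\<bar> \<le> B"
      then have "\<bar>X 0 \<omega>\<bar> \<le> B" using t by simp
      then have "0 \<le> B" using abs_ge_zero order_trans by blast
      have R_le: "\<bar>R m \<omega>\<bar> \<le> 2 * g t * \<bar>c\<bar> * B" for m
      proof -
        have "R m \<omega> = c * (\<Sum>i<Suc m. g (s m i) * (X (s m (Suc i)) \<omega> - X (s m i) \<omega>))"
          unfolding R_def sum_distrib_left by (intro sum.cong) auto
        then have "\<bar>R m \<omega>\<bar> = \<bar>c\<bar> * \<bar>\<Sum>i<Suc m. g (s m i) * (X (s m (Suc i)) \<omega> - X (s m i) \<omega>)\<bar>"
          by (simp only: abs_mult)
        also have "\<dots> \<le> \<bar>c\<bar> * (2 * g (s m m) * B)"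
        proof (intro mult_left_mono abs_sum_mult_increments_le)
          show "0 \<le> g (s m 0)" using g(1) by (simp add: s_end)
          show "g (s m i) \<le> g (s m (Suc i))" if "i < m" for i
            using that g(2) by (intro mono_onD[OF g(2)] s_mono) (auto intro!: s_nonneg s_le)
          show "\<bar>X (s m i) \<omega>\<bar> \<le> B" if "i \<le> Suc m" for i
            using B s_le[OF that] s_nonneg by auto
        qed simp
        also have "\<dots> \<le> \<bar>c\<bar> * (2 * g t * B)"
          using \<open>0 \<le> B\<close> t by (intro mult_left_mono mult_right_mono mono_onD[OF g(2)])
            (auto intro!: s_nonneg s_le)
        finally show ?thesis by (simp add: mult_ac)
      qed
      have "(\<lambda>k. (1/2)^k :: real) \<longlonglongrightarrow> 0" by (rule LIMSEQ_realpow_zero) auto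
      then have "(\<lambda>k. 2 * g t * \<bar>c\<bar> * B + (1/2)^k) \<longlonglongrightarrow> 2 * g t * \<bar>c\<bar> * B + 0"
        by (intro tendsto_add tendsto_const)
      moreover have "\<forall>\<^sub>F k in sequentially. \<bar>I \<omega>\<bar> \<le> 2 * g t * \<bar>c\<bar> * B + (1/2)^k"
        using elim
      proof eventually_elim
        case (elim k)
        then have "\<bar>R (n k) \<omega> - I \<omega>\<bar> \<le> (1/2)^k" by auto
        then show ?case using R_le[of "n k"] by linarith
      qed
      ultimately show "\<bar>I \<omega>\<bar> \<le> 2 * g t * \<bar>c\<bar> * B"
        using tendsto_lowerbound[of _ _ sequentially "\<bar>I \<omega>\<bar>"] by simp
    qed
  qed
qed

lemma eigval_pos: "k \<in> Zstar \<Longrightarrow> 0 < eigval k"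
  using eigval_ge_1[of k] by simp

text \<open>Since \<gamma>_k \<ge> k^2, the sum is dominated by two copies of the series of n^(-2
  s), one for each sign of k.\<close>

lemma summable_on_Zstar_eigval_powr:
  assumes "1 / 2 < s"
  shows "(\<lambda>k. eigval k powr - s) summable_on Zstar"
proof -
  have "summable (\<lambda>n. real (Suc n) powr (- 2 * s))"
    using assms summable_Suc_iff[of "\<lambda>n. real n powr (- 2 * s)"] by (simp add: summable_real_powr_iff)
  then have nat: "(\<lambda>n. real (Suc n) powr (- 2 * s)) summable_on UNIV"
    by (intro norm_summable_imp_summable_on) simp
  define pos neg where "pos = (\<lambda>n. int (Suc n))" and "neg = (\<lambda>n. - int (Suc n))"
  have Z: "Zstar = range pos \<union> range neg"
  proof (intro equalityI subsetI)
    fix k assume "k \<in> Zstar"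
    then have "k = pos (nat (k - 1)) \<or> k = neg (nat (- k - 1))"
      by (auto simp: Zstar_def pos_def neg_def)
    then show "k \<in> range pos \<union> range neg" by blast
  qed (auto simp: Zstar_def pos_def neg_def)
  have "(\<lambda>k. \<bar>of_int k\<bar> powr (- 2 * s)) summable_on range pos"
    using nat by (subst summable_on_reindex) (auto simp: inj_on_def pos_def o_def add.commute)
  moreover have "(\<lambda>k. \<bar>of_int k\<bar> powr (- 2 * s)) summable_on range neg"
    using nat by (subst summable_on_reindex) (auto simp: inj_on_def neg_def o_def add.commute)
  ultimately have "(\<lambda>k. \<bar>of_int k\<bar> powr (- 2 * s)) summable_on Zstar"
    unfolding Z by (intro summable_on_Un_disjoint) (auto simp: pos_def neg_def)
  then show ?thesis
  proof (rule summable_on_comparison_test)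
    fix k assume k: "k \<in> Zstar"
    have "1 * \<bar>real_of_int k\<bar>\<^sup>2 \<le> eigval k"
    proof -
      have "1 \<le> 4 * pi\<^sup>2" using one_le_power[of pi 2] pi_gt3 by linarith
      then show ?thesis unfolding eigval_def by (rule mult_right_mono) simp
    qed
    moreover have "0 < \<bar>real_of_int k\<bar>" using k by (simp add: Zstar_def)
    ultimately have "eigval k powr - s \<le> (\<bar>real_of_int k\<bar>\<^sup>2) powr - s"
      using assms by (intro powr_mono2') auto
    also have "\<dots> = \<bar>real_of_int k\<bar> powr (- 2 * s)"
      unfolding powr_numeral[OF abs_ge_zero, symmetric] powr_powr by simp
    finally show "eigval k powr - s \<le> \<bar>of_int k\<bar> powr (- 2 * s)" .
  qed simp
qed

section \<open>Tails and moments of the convolution\<close>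

context stable_convolution
begin

lemma z_measurable: "k \<in> Zstar \<Longrightarrow> 0 \<le> t \<Longrightarrow> z k t \<in> borel_measurable M"
  using convolution by (auto simp: has_stoch_integral_def)

text \<open>The kernel exp(-\<gamma>_k (d - s)) increases in s up to the value 1 at s = d, so the
  bound involves neither \<gamma>_k nor d. Each d has its own null set, and the countable grid
  allows them to be merged; right-continuity extends the bound on \<open>l k\<close> from the grid
  to all times.\<close>

lemma AE_z_bound:
  assumes k: "k \<in> Zstar" and T: "0 \<le> T"
  shows "AE \<omega> in M. \<forall>x. (\<forall>d\<in>dyadic_grid T. \<bar>l k d \<omega>\<bar> \<le> x) \<longrightarrow> (\<forall>d\<in>dyadic_grid T. \<bar>z k d \<omega>\<bar> \<le> 2 * \<bar>b k\<bar> * x)"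
proof -
  note stable_k = stable[OF k, unfolded sym_stable_process_def]
  have "AE \<omega> in M. \<forall>B. (\<forall>s\<in>{0..d}. \<bar>l k s \<omega>\<bar> \<le> B) \<longrightarrow> \<bar>z k d \<omega>\<bar> \<le> 2 * exp (- eigval k * (d - d)) * \<bar>b k\<bar> * B"
    if "d \<in> dyadic_grid T" for d
  proof (rule stoch_integral_bound[where X = "l k" and g = "\<lambda>s. exp (- eigval k * (d - s))"])
    show d: "0 \<le> d" using that dyadic_grid_subset[OF T] by auto
    show "has_stoch_integral (l k) (\<lambda>s. exp (- eigval k * (d - s)) * b k) d (z k d)"
      by (rule convolution[OF k d])
    show "mono_on {0..d} (\<lambda>s. exp (- eigval k * (d - s)))"
      using eigval_pos[OF k] by (auto intro!: mono_onI)
  qed (use stable_k in auto)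
  then have "AE \<omega> in M. \<forall>d\<in>dyadic_grid T. \<forall>B. (\<forall>s\<in>{0..d}. \<bar>l k s \<omega>\<bar> \<le> B) \<longrightarrow> \<bar>z k d \<omega>\<bar> \<le> 2 * \<bar>b k\<bar> * B"
    by (subst AE_ball_countable[OF countable_dyadic_grid]) simp
  with AE_space show ?thesis
  proof eventually_elim
    case (elim \<omega>)
    show ?case
    proof (intro allI impI ballI)
      fix x d assume x: "\<forall>d\<in>dyadic_grid T. \<bar>l k d \<omega>\<bar> \<le> x" and d: "d \<in> dyadic_grid T"
      have "cadlag (\<lambda>t. l k t \<omega>)" using stable_k elim(1) by blast
      then have "((\<lambda>t. \<bar>l k t \<omega>\<bar>) \<longlongrightarrow> \<bar>l k t \<omega>\<bar>) (at_right t)" if "0 \<le> t" for t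
        using that unfolding cadlag_def by (intro tendsto_rabs) simp
      then have "\<bar>l k s \<omega>\<bar> \<le> x" if "0 \<le> s" "s \<le> T" for s
        by (rule le_of_dyadic_grid_le) (use x that in auto)
      moreover have "d \<le> T" using d dyadic_grid_subset[OF T] by auto
      ultimately show "\<bar>z k d \<omega>\<bar> \<le> 2 * \<bar>b k\<bar> * x" using elim(2) d by auto
    qed
  qed
qed

lemma z_sup_tail:
  assumes k: "k \<in> Zstar" and "0 \<le> T" "0 < \<alpha>" "0 < w" "b k \<noteq> 0" "0 < y"
  shows "emeasure M {\<omega> \<in> space M. ennreal y < (SUP d\<in>dyadic_grid T. ennreal (w * (z k d \<omega>)\<^sup>2))}
    \<le> ennreal (2 * stable_tail_const \<alpha> * T * (6 * \<bar>b k\<bar> * sqrt w) powr \<alpha> * y powr - (\<alpha> / 2))"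
proof -
  \<comment> \<open>The level for \<open>l k\<close> at which the bound 2 |b k| x on
    \<open>z k\<close> makes the weighted square equal to \<open>y\<close>.\<close>
  define x where "x = sqrt y / (2 * \<bar>b k\<bar> * sqrt w)"
  have x: "0 < x" using assms by (simp add: x_def)
  have xy: "w * (2 * \<bar>b k\<bar> * x)\<^sup>2 = y" using assms by (simp add: x_def power_divide power_mult_distrib)
  have [measurable]: "l k d \<in> borel_measurable M" if "d \<in> dyadic_grid T" for d
    using stable[OF k] that dyadic_grid_subset[OF \<open>0 \<le> T\<close>] by (auto simp: sym_stable_process_def)
  note [measurable] = countable_dyadic_grid
  have "emeasure M {\<omega> \<in> space M. ennreal y < (SUP d\<in>dyadic_grid T. ennreal (w * (z k d \<omega>)\<^sup>2))}
      \<le> emeasure M {\<omega> \<in> space M. \<exists>d\<in>dyadic_grid T. x < \<bar>l k d \<omega>\<bar>}"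
  proof (rule emeasure_mono_AE)
    show "AE \<omega> in M. \<omega> \<in> {\<omega> \<in> space M. ennreal y < (SUP d\<in>dyadic_grid T. ennreal (w * (z k d \<omega>)\<^sup>2))}
        \<longrightarrow> \<omega> \<in> {\<omega> \<in> space M. \<exists>d\<in>dyadic_grid T. x < \<bar>l k d \<omega>\<bar>}"
      using AE_z_bound[OF k \<open>0 \<le> T\<close>]
    proof eventually_elim
      case (elim \<omega>)
      have "(SUP d\<in>dyadic_grid T. ennreal (w * (z k d \<omega>)\<^sup>2)) \<le> ennreal y"
        if "\<forall>d\<in>dyadic_grid T. \<bar>l k d \<omega>\<bar> \<le> x"
      proof (rule SUP_least, rule ennreal_leI)
        fix d assume "d \<in> dyadic_grid T"
        then have "\<bar>z k d \<omega>\<bar> \<le> 2 * \<bar>b k\<bar> * x" using elim that by blast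
        then have "(z k d \<omega>)\<^sup>2 \<le> (2 * \<bar>b k\<bar> * x)\<^sup>2" using x by (simp add: power2_le_iff_abs_le)
        then show "w * (z k d \<omega>)\<^sup>2 \<le> y" unfolding xy[symmetric] using \<open>0 < w\<close> by simp
      qed
      then show ?case by (auto simp: not_less[symmetric])
    qed
  qed measurable
  also have "\<dots> \<le> ennreal (2 * stable_tail_const \<alpha> * T * (x / 3) powr - \<alpha>)"
    using stable_sup_tail[OF stable[OF k]] assms x by (simp add: emeasure_eq_measure ennreal_leI)
  \<comment> \<open>The 6 is the 2 from summation by parts times the 3 from the maximal
    inequality.\<close>
  also have "(x / 3) powr - \<alpha> = (6 * \<bar>b k\<bar> * sqrt w) powr \<alpha> * y powr - (\<alpha> / 2)"
  proof -
    have "x / 3 = sqrt y / (6 * \<bar>b k\<bar> * sqrt w)" by (simp add: x_def)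
    then have "(x / 3) powr - \<alpha> = sqrt y powr - \<alpha> / (6 * \<bar>b k\<bar> * sqrt w) powr - \<alpha>"
      using assms by (simp only: powr_divide)
    also have "sqrt y powr - \<alpha> = y powr - (\<alpha> / 2)"
      using \<open>0 < y\<close> by (simp add: powr_powr flip: powr_half_sqrt)
    finally show ?thesis by (simp add: powr_minus_divide[of _ \<alpha>])
  qed
  finally show ?thesis by (simp add: mult_ac)
qed

text \<open>The full norm need not be right-continuous in t, but every finite partial sum of its
  square is. The two suprema are therefore exchanged first, and time is reduced to the grid with
  \<open>F\<close> fixed. The resulting countable suprema serve both measurability and the moment
  bound.\<close>

lemma sup_norm_eq:
  assumes \<omega>: "\<omega> \<in> space M" and "0 \<le> \<theta>" "0 \<le> T" "0 < p"
  shows "(SUP t\<in>{0..T}. epowr (norm_A_pow_ext \<theta> (Z_conv z t \<omega>)) p)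
    = epowr (SUP F\<in>{F. finite F \<and> F \<subseteq> Zstar}. SUP d\<in>dyadic_grid T.
        \<Sum>k\<in>F. ennreal (eigval k powr (2 * \<theta>) * (z k d \<omega>)\<^sup>2)) (p / 2)"
proof -
  let ?h = "\<lambda>F t. \<Sum>k\<in>F. ennreal (eigval k powr (2 * \<theta>) * (z k t \<omega>)\<^sup>2)"
  have "(SUP t\<in>{0..T}. epowr (norm_A_pow_ext \<theta> (Z_conv z t \<omega>)) p)
      = (SUP t\<in>{0..T}. epowr (SUP F\<in>{F. finite F \<and> F \<subseteq> Zstar}. ?h F t) (p / 2))"
    by (simp add: Z_conv_def norm_A_pow_ext_series_H[OF \<open>0 \<le> \<theta>\<close>] epowr_epowr infsum_ennreal_SUP)
  also have "\<dots> = epowr (SUP t\<in>{0..T}. SUP F\<in>{F. finite F \<and> F \<subseteq> Zstar}. ?h F t) (p / 2)"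
    using \<open>0 < p\<close> by (intro epowr_SUP) simp
  also have "(SUP t\<in>{0..T}. SUP F\<in>{F. finite F \<and> F \<subseteq> Zstar}. ?h F t)
      = (SUP F\<in>{F. finite F \<and> F \<subseteq> Zstar}. SUP t\<in>{0..T}. ?h F t)"
    by (rule SUP_commute)
  also have "\<dots> = (SUP F\<in>{F. finite F \<and> F \<subseteq> Zstar}. SUP d\<in>dyadic_grid T. ?h F d)"
  proof (rule SUP_cong[OF refl], rule antisym)
    fix F assume F: "F \<in> {F. finite F \<and> F \<subseteq> Zstar}"
    show "(SUP d\<in>dyadic_grid T. ?h F d) \<le> (SUP t\<in>{0..T}. ?h F t)"
      using dyadic_grid_subset[OF \<open>0 \<le> T\<close>] by (intro SUP_subset_mono) auto
    show "(SUP t\<in>{0..T}. ?h F t) \<le> (SUP d\<in>dyadic_grid T. ?h F d)"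
    proof (rule SUP_least)
      fix t assume t: "t \<in> {0..T}"
      show "?h F t \<le> (SUP d\<in>dyadic_grid T. ?h F d)"
      proof (rule le_of_dyadic_grid_le[where f = "?h F"])
        fix t :: real assume "0 \<le> t"
        have "((\<lambda>t. z k t \<omega>) \<longlongrightarrow> z k t \<omega>) (at_right t)" if "k \<in> F" for k
          using that F cadlag_z[OF _ \<omega>] \<open>0 \<le> t\<close> by (auto simp: cadlag_def)
        then show "(?h F \<longlongrightarrow> ?h F t) (at_right t)" by (intro tendsto_intros)
      qed (use t in \<open>auto intro: SUP_upper\<close>)
    qed
  qed
  finally show ?thesis .
qed

lemma sup_norm_measurable:
  assumes "0 \<le> \<theta>" "0 \<le> T" "0 < p"
  shows "(\<lambda>\<omega>. SUP t\<in>{0..T}. epowr (norm_A_pow_ext \<theta> (Z_conv z t \<omega>)) p) \<in> borel_measurable M"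
proof -
  have "(\<lambda>\<omega>. SUP F\<in>{F. finite F \<and> F \<subseteq> Zstar}. SUP d\<in>dyadic_grid T.
      \<Sum>k\<in>F. ennreal (eigval k powr (2 * \<theta>) * (z k d \<omega>)\<^sup>2)) \<in> borel_measurable M"
  proof (intro borel_measurable_SUP)
    show "countable {F. finite F \<and> F \<subseteq> Zstar}"
      by (rule countable_Collect_finite_subset) simp
    fix F d assume F: "F \<in> {F. finite F \<and> F \<subseteq> Zstar}" and d: "d \<in> dyadic_grid T"
    have [measurable]: "z k d \<in> borel_measurable M" if "k \<in> F" for k
      using that F d dyadic_grid_subset[OF \<open>0 \<le> T\<close>] by (intro z_measurable) auto
    show "(\<lambda>\<omega>. \<Sum>k\<in>F. ennreal (eigval k powr (2 * \<theta>) * (z k d \<omega>)\<^sup>2)) \<in> borel_measurable M"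
      by measurable
  qed (rule countable_dyadic_grid)
  then have "(\<lambda>\<omega>. epowr (SUP F\<in>{F. finite F \<and> F \<subseteq> Zstar}. SUP d\<in>dyadic_grid T.
      \<Sum>k\<in>F. ennreal (eigval k powr (2 * \<theta>) * (z k d \<omega>)\<^sup>2)) (p / 2)) \<in> borel_measurable M"
    by measurable
  then show ?thesis using assms by (subst measurable_cong[OF sup_norm_eq]) auto
qed

text \<open>The constant is explicit so that it visibly depends on neither the probability space nor
  T; \<open>c\<close> and \<open>s\<close> are the factor and the decay rate in the bound on the
  weighted noise coefficients.\<close>

lemma sup_norm_moment:
  assumes p: "0 < p" "p < \<alpha>" "\<alpha> < 2" and \<theta>: "0 \<le> \<theta>" and T: "0 < T" and c: "0 \<le> c" "1 / 2 < s"
    and b: "\<And>k. k \<in> Zstar \<Longrightarrow> b k \<noteq> 0"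
    and b_le: "\<And>k. k \<in> Zstar \<Longrightarrow> (\<bar>b k\<bar> * eigval k powr \<theta>) powr \<alpha> \<le> c * eigval k powr - s"
  shows "(\<integral>\<^sup>+\<omega>. (SUP t\<in>{0..T}. epowr (norm_A_pow_ext \<theta> (Z_conv z t \<omega>)) p) \<partial>M)
    \<le> ennreal ((1 + sum_tail_const (\<alpha> / 2) * (2 * stable_tail_const \<alpha> * 6 powr \<alpha> * c
          * (\<Sum>\<^sub>\<infinity>k\<in>Zstar. eigval k powr - s))) powr (p / \<alpha>)
        * moment_const (p / 2) (\<alpha> / 2) * T powr (p / \<alpha>))"
proof -
  have \<alpha>: "0 < \<alpha>" using p by simp
  let ?W = "\<Sum>\<^sub>\<infinity>k\<in>Zstar. eigval k powr - s"
  define D where "D = 2 * stable_tail_const \<alpha> * 6 powr \<alpha> * c"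
  have D: "0 \<le> D" unfolding D_def using stable_tail_const_nonneg[OF \<alpha>] c by simp
  define \<kappa> where "\<kappa> = from_nat_into Zstar"
  have bij: "bij_betw \<kappa> UNIV Zstar"
    unfolding \<kappa>_def using countable_infinite_Zstar by (rule bij_betw_from_nat_into)
  then have \<kappa>: "\<kappa> i \<in> Zstar" for i by (auto simp: bij_betw_def)
  define A where "A = (\<lambda>i. D * T * eigval (\<kappa> i) powr - s)"
  have A0: "0 \<le> A i" for i unfolding A_def using D T by simp
  have summ: "(\<lambda>i. eigval (\<kappa> i) powr - s) summable_on UNIV"
    using summable_on_Zstar_eigval_powr[OF c(2)] summable_on_reindex_bij_betw[OF bij, of "\<lambda>k. eigval k powr - s"]
    by simp
  have "(\<lambda>i. eigval (\<kappa> i) powr - s) sums (\<Sum>\<^sub>\<infinity>i. eigval (\<kappa> i) powr - s)"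
    using summ by (intro has_sum_imp_sums has_sum_infsum)
  also have "(\<Sum>\<^sub>\<infinity>i. eigval (\<kappa> i) powr - s) = ?W"
    by (rule infsum_reindex_bij_betw[OF bij])
  finally have A_sums: "A sums (D * T * ?W)" unfolding A_def by (rule sums_mult)
  have W: "0 \<le> ?W" by (intro infsum_nonneg) simp
  \<comment> \<open>The supremum of a sum is at most the sum of the suprema; taking it mode by mode
    leaves variables whose tails are known individually.\<close>
  define Y where "Y = (\<lambda>i \<omega>. SUP d\<in>dyadic_grid T. ennreal (eigval (\<kappa> i) powr (2 * \<theta>) * (z (\<kappa> i) d \<omega>)\<^sup>2))"
  have [measurable]: "Y i \<in> borel_measurable M" for i
    unfolding Y_def
  proof (intro borel_measurable_SUP countable_dyadic_grid)
    fix d assume "d \<in> dyadic_grid T"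
    then have [measurable]: "z (\<kappa> i) d \<in> borel_measurable M"
      using dyadic_grid_subset[of T] T \<kappa> by (intro z_measurable) auto
    show "(\<lambda>\<omega>. ennreal (eigval (\<kappa> i) powr (2 * \<theta>) * (z (\<kappa> i) d \<omega>)\<^sup>2)) \<in> borel_measurable M" by measurable
  qed
  have Y_tail: "emeasure M {\<omega> \<in> space M. ennreal y < Y i \<omega>} \<le> ennreal (A i * y powr - (\<alpha> / 2))"
    if "0 < y" for i y
  proof -
    have g: "0 < eigval (\<kappa> i)" by (rule eigval_pos[OF \<kappa>])
    have "emeasure M {\<omega> \<in> space M. ennreal y < Y i \<omega>}
      \<le> ennreal (2 * stable_tail_const \<alpha> * T * (6 * \<bar>b (\<kappa> i)\<bar> * sqrt (eigval (\<kappa> i) powr (2 * \<theta>))) powr \<alpha> * y powr - (\<alpha> / 2))"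
      unfolding Y_def using T \<alpha> that g by (intro z_sup_tail \<kappa> b) auto
    also have "sqrt (eigval (\<kappa> i) powr (2 * \<theta>)) = eigval (\<kappa> i) powr \<theta>"
      using g by (simp add: powr_half_sqrt[symmetric] powr_powr)
    also have "6 * \<bar>b (\<kappa> i)\<bar> * eigval (\<kappa> i) powr \<theta> = 6 * (\<bar>b (\<kappa> i)\<bar> * eigval (\<kappa> i) powr \<theta>)" by simp
    also have "2 * stable_tail_const \<alpha> * T * (6 * (\<bar>b (\<kappa> i)\<bar> * eigval (\<kappa> i) powr \<theta>)) powr \<alpha> * y powr - (\<alpha> / 2)
        \<le> 2 * stable_tail_const \<alpha> * T * (6 powr \<alpha> * (c * eigval (\<kappa> i) powr - s)) * y powr - (\<alpha> / 2)"
      using T stable_tail_const_nonneg[OF \<alpha>] b_le[OF \<kappa>, of i]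
      unfolding powr_mult[of 6] by (intro mult_left_mono mult_right_mono) auto
    also have "\<dots> = A i * y powr - (\<alpha> / 2)" by (simp add: A_def D_def)
    finally show ?thesis by (simp add: ennreal_leI)
  qed
  \<comment> \<open>The added 1 keeps \<open>K\<close> positive even if \<open>c\<close> is 0, as
    \<open>moment_le_tail\<close> requires a positive tail constant.\<close>
  define K where "K = 1 + sum_tail_const (\<alpha> / 2) * (D * ?W)"
  have K: "0 < K"
    unfolding K_def using sum_tail_const_nonneg[of "\<alpha> / 2"] D W p by (intro add_pos_nonneg mult_nonneg_nonneg) auto
  have "(\<integral>\<^sup>+\<omega>. (SUP t\<in>{0..T}. epowr (norm_A_pow_ext \<theta> (Z_conv z t \<omega>)) p) \<partial>M)
      \<le> (\<integral>\<^sup>+\<omega>. epowr (\<Sum>i. Y i \<omega>) (p / 2) \<partial>M)"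
  proof (rule nn_integral_mono)
    fix \<omega> assume \<omega>: "\<omega> \<in> space M"
    have "(SUP F\<in>{F. finite F \<and> F \<subseteq> Zstar}. SUP d\<in>dyadic_grid T.
        \<Sum>k\<in>F. ennreal (eigval k powr (2 * \<theta>) * (z k d \<omega>)\<^sup>2)) \<le> (\<Sum>i. Y i \<omega>)"
    proof (intro SUP_least)
      fix F d assume F: "F \<in> {F. finite F \<and> F \<subseteq> Zstar}" and d: "d \<in> dyadic_grid T"
      define G where "G = \<kappa> -` F"
      have FG: "F = \<kappa> ` G" using bij F by (auto simp: G_def bij_betw_def)
      have G: "finite G" "inj_on \<kappa> G"
        unfolding G_def using bij F
        by (auto simp: bij_betw_def intro!: finite_vimageI intro: inj_on_subset)
      have "(\<Sum>k\<in>F. ennreal (eigval k powr (2 * \<theta>) * (z k d \<omega>)\<^sup>2))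
          = (\<Sum>i\<in>G. ennreal (eigval (\<kappa> i) powr (2 * \<theta>) * (z (\<kappa> i) d \<omega>)\<^sup>2))"
        unfolding FG using G(2) by (simp add: sum.reindex)
      also have "\<dots> \<le> (\<Sum>i\<in>G. Y i \<omega>)"
        unfolding Y_def using d by (intro sum_mono SUP_upper)
      also have "\<dots> \<le> (\<Sum>i. Y i \<omega>)" using G(1) by (intro sum_le_suminf) auto
      finally show "(\<Sum>k\<in>F. ennreal (eigval k powr (2 * \<theta>) * (z k d \<omega>)\<^sup>2)) \<le> (\<Sum>i. Y i \<omega>)" .
    qed
    then show "(SUP t\<in>{0..T}. epowr (norm_A_pow_ext \<theta> (Z_conv z t \<omega>)) p) \<le> epowr (\<Sum>i. Y i \<omega>) (p / 2)"
      using sup_norm_eq[OF \<omega> \<theta> _ p(1), of T] T p by (simp add: epowr_mono)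
  qed
  also have "\<dots> \<le> ennreal ((K * T) powr ((p / 2) / (\<alpha> / 2)) * moment_const (p / 2) (\<alpha> / 2))"
  proof (rule moment_le_tail)
    fix y :: real assume y: "0 < y"
    have "emeasure M {\<omega> \<in> space M. ennreal y < (\<Sum>i. Y i \<omega>)}
        \<le> ennreal (sum_tail_const (\<alpha> / 2) * suminf A * y powr - (\<alpha> / 2))"
      using Y_tail A0 A_sums y p by (intro suminf_tail) (auto simp: sums_iff)
    also have "\<dots> \<le> ennreal (K * T * y powr - (\<alpha> / 2))"
    proof (intro ennreal_leI mult_right_mono)
      have "sum_tail_const (\<alpha> / 2) * suminf A = (K - 1) * T"
        using A_sums by (simp add: K_def sums_iff algebra_simps)
      then show "sum_tail_const (\<alpha> / 2) * suminf A \<le> K * T" using T by (simp add: algebra_simps)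
    qed simp
    finally show "emeasure M {\<omega> \<in> space M. ennreal y < (\<Sum>i. Y i \<omega>)} \<le> ennreal (K * T * y powr - (\<alpha> / 2))" .
  qed (use p K T in auto)
  also have "(K * T) powr ((p / 2) / (\<alpha> / 2)) * moment_const (p / 2) (\<alpha> / 2)
      = K powr (p / \<alpha>) * moment_const (p / 2) (\<alpha> / 2) * T powr (p / \<alpha>)"
    using K T by (simp add: powr_mult)
  finally show ?thesis by (simp add: K_def D_def)
qed

end

theorem lemma3p1:
  fixes \<alpha> \<beta> \<theta> p C1 C2 :: real and b :: "int \<Rightarrow> real"
  assumes "1 < \<alpha>" "\<alpha> < 2"
    and "\<beta> > 1 / 2 + 1 / (2 * \<alpha>)"
    and "C1 > 0" "C2 > 0"
    and "\<And>k. k \<in> Zstar \<Longrightarrow>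
           C1 * eigval k powr (- \<beta>) \<le> \<bar>b k\<bar> \<and> \<bar>b k\<bar> \<le> C2 * eigval k powr (- \<beta>)"
    and "0 \<le> \<theta>" "\<theta> < \<beta> - 1 / (2 * \<alpha>)"
    and "0 < p" "p < \<alpha>"
  shows "\<exists>C::real. \<forall>(M::'a measure) l z T. stable_convolution M \<alpha> b l z \<and> T > 0 \<longrightarrow>
           (\<lambda>\<omega>. SUP t\<in>{0..T}. epowr (norm_A_pow_ext \<theta> (Z_conv z t \<omega>)) p) \<in> borel_measurable M \<and>
           (\<integral>\<^sup>+\<omega>. (SUP t\<in>{0..T}. epowr (norm_A_pow_ext \<theta> (Z_conv z t \<omega>)) p) \<partial>M)
             \<le> ennreal (C * T powr (p / \<alpha>))"
proof (intro exI allI impI conjI; elim conjE)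
  \<comment> \<open>The decay rate of (|b k| \<gamma>_k^\<theta>)^\<alpha>; the condition s > 1/2
    restates \<theta> < \<beta> - 1/(2\<alpha>).\<close>
  define s where "s = (\<beta> - \<theta>) * \<alpha>"
  have s: "1 / 2 < s" using assms(1,8) by (simp add: s_def field_simps)
  \<comment> \<open>The lower bound on the noise coefficients permits the division by |b k| in the
    level chosen in \<open>z_sup_tail\<close>.\<close>
  have b_nz: "b k \<noteq> 0" if "k \<in> Zstar" for k
  proof -
    have "0 < C1 * eigval k powr - \<beta>" using eigval_pos[OF that] assms(4) by simp
    then show ?thesis using assms(6)[OF that] by auto
  qed
  have b_le: "(\<bar>b k\<bar> * eigval k powr \<theta>) powr \<alpha> \<le> C2 powr \<alpha> * eigval k powr - s" if k: "k \<in> Zstar" for k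
  proof -
    have "\<bar>b k\<bar> * eigval k powr \<theta> \<le> C2 * eigval k powr - \<beta> * eigval k powr \<theta>"
      using assms(6)[OF k] by (intro mult_right_mono) auto
    also have "\<dots> = C2 * eigval k powr (\<theta> - \<beta>)" by (simp add: powr_add[symmetric])
    finally have "(\<bar>b k\<bar> * eigval k powr \<theta>) powr \<alpha> \<le> (C2 * eigval k powr (\<theta> - \<beta>)) powr \<alpha>"
      using assms(1) by (intro powr_mono2) auto
    also have "\<dots> = C2 powr \<alpha> * eigval k powr - s"
      using assms(5) by (simp add: powr_mult powr_powr s_def algebra_simps)
    finally show ?thesis .
  qed
  fix M :: "'a measure" and l z :: "int \<Rightarrow> real \<Rightarrow> 'a \<Rightarrow> real" and T :: real
  assume sc: "stable_convolution M \<alpha> b l z" and T: "T > 0"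
  interpret stable_convolution M \<alpha> b l z by (rule sc)
  show "(\<lambda>\<omega>. SUP t\<in>{0..T}. epowr (norm_A_pow_ext \<theta> (Z_conv z t \<omega>)) p) \<in> borel_measurable M"
    using assms T by (intro sup_norm_measurable) auto
  \<comment> \<open>The witness for \<open>C\<close> is read off here; it is spelled out in the
    parameters of the theorem alone, hence common to all \<open>M\<close>, \<open>l\<close>,
    \<open>z\<close> and \<open>T\<close>.\<close>
  show "(\<integral>\<^sup>+\<omega>. (SUP t\<in>{0..T}. epowr (norm_A_pow_ext \<theta> (Z_conv z t \<omega>)) p) \<partial>M)
      \<le> ennreal ((1 + sum_tail_const (\<alpha> / 2) * (2 * stable_tail_const \<alpha> * 6 powr \<alpha> * C2 powr \<alpha>
          * (\<Sum>\<^sub>\<infinity>k\<in>Zstar. eigval k powr - ((\<beta> - \<theta>) * \<alpha>)))) powr (p / \<alpha>)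
        * moment_const (p / 2) (\<alpha> / 2) * T powr (p / \<alpha>))"
    using assms T s b_nz b_le unfolding s_def by (intro sup_norm_moment) auto
qed

end
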